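(* In the Traditional Model with nonnegative inputs $x_1,\dots,x_n$, let $G$ be a totally positive generalized Vandermonde matrix $G_{ij}=x_i^{\mu_j}$, $1\le i,j\le n$, where the $\mu_j$ form an increasing nonnegative sequence of integers, and let $\lambda=(\lambda_j)$ be the partition $\lambda_j=\mu_{n+1-j}-(n-j)$. Then $\det(G)$, which equals the product of $\prod_{i<j}(x_j-x_i)$ and the Schur function $s_\lambda(x_1,\dots,x_n)$, can be evaluated accurately, and the cost of evaluating it can be reduced (from the exponential cost $O(n^{|\lambda|})$, $|\lambda|=\sum_j\lambda_j$, of straightforward evaluation) to polynomial time $n^2\prod_j(\lambda_j+1)^2$, where the $\lambda_j$ are counted as part of the size of the input.
   Context: A matrix is totally positive if all of its minors are positive. The Schur function $s_\lambda(x_1,\dots,x_n)$ is the polynomial $\det(x_i^{\lambda_j+n-j})/\det(x_i^{n-j})$; it has nonnegative integer coefficients. Traditional Model (TM): the input data are given exactly, and the floating point result of an operation $\otimes\in\{+,-,\times,\div\}$ is $fl(a\otimes b)=(a\otimes b)(1+\delta)$, where $\delta$ may be an arbitrary number with $|\delta|\le\epsilon$, and $\epsilon\ll 1$ is the machine precision. The size of the input in the TM is the number of floating point words needed to describe it, independent of $\epsilon$; here the $\lambda_j$ are additionally counted as part of the size of the input. "Accurately" means that the relative error in the output is less than one, no matter how tiny the exact output is. "Polynomial time" means time bounded by a polynomial function of the input size. *)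

theory Defs
  imports
    Complex_Main
    "HOL-Computational_Algebra.Polynomial"
    "Jordan_Normal_Form.Determinant"
    "Jordan_Normal_Form.DL_Submatrix"
begin

section \<open>Matrices and Schur functions\<close>

text \<open>Sequences such as x, \<mu>, \<lambda> are functions on nat whose relevant indices are 1, ..., n; matrix
  entries in the library are indexed from 0, hence the shifts by Suc.\<close>

definition totally_positive :: "real mat \<Rightarrow> bool" where
  "totally_positive A \<longleftrightarrow>
     (\<forall>I J. I \<subseteq> {..<dim_row A} \<longrightarrow> J \<subseteq> {..<dim_col A} \<longrightarrow> I \<noteq> {} \<longrightarrow> card I = card J \<longrightarrow>
        0 < det (submatrix A I J))"

definition gen_vandermonde :: "nat \<Rightarrow> (nat \<Rightarrow> nat) \<Rightarrow> (nat \<Rightarrow> real) \<Rightarrow> real mat" where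
  "gen_vandermonde n \<mu> x = mat n n (\<lambda>(i, j). x (Suc i) ^ \<mu> (Suc j))"

text \<open>For strictly increasing \<mu> and 1 \<le> j \<le> n one has \<mu> (n + 1 - j) \<ge> n - j, so the
  subtraction on nat does not truncate.\<close>

definition partition_of :: "nat \<Rightarrow> (nat \<Rightarrow> nat) \<Rightarrow> nat \<Rightarrow> nat" where
  "partition_of n \<mu> j = \<mu> (n + 1 - j) - (n - j)"

text \<open>The value of the Schur polynomial in n variables, as the bialternant quotient. The quotient is
  meaningful at points with pairwise distinct coordinates.\<close>

definition schur :: "nat \<Rightarrow> (nat \<Rightarrow> nat) \<Rightarrow> (nat \<Rightarrow> real) \<Rightarrow> real" where
  "schur n lam x =
     det (mat n n (\<lambda>(i, j). x (Suc i) ^ (lam (Suc j) + (n - Suc j))))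
     / det (mat n n (\<lambda>(i, j). x (Suc i) ^ (n - Suc j)))"

section \<open>Algorithms in the Traditional Model\<close>

text \<open>A program acts on an array of floating point words. Its control flow and its addresses depend
  only on n and \<lambda>, through index expressions (natural number arithmetic with truncated
  subtraction); \<open>Var v\<close> is the counter of an enclosing loop.\<close>

datatype idx =
    Lit nat
  | Var nat
  | Size
  | Lam idx
  | Plus idx idx
  | Minus idx idx
  | Times idx idx

datatype arith = Add | Sub | Mul | Div

datatype prog =
    Const idx nat
  | Copy idx idx
  | Op arith idx idx idx
  | Skip
  | Seq prog prog
  | IfLess idx idx prog prog
  | For nat idx prog

primrec ival :: "nat \<Rightarrow> (nat \<Rightarrow> nat) \<Rightarrow> (nat \<Rightarrow> nat) \<Rightarrow> idx \<Rightarrow> nat" where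
  "ival n lam env (Lit k) = k"
| "ival n lam env (Var v) = env v"
| "ival n lam env Size = n"
| "ival n lam env (Lam a) = lam (ival n lam env a)"
| "ival n lam env (Plus a b) = ival n lam env a + ival n lam env b"
| "ival n lam env (Minus a b) = ival n lam env a - ival n lam env b"
| "ival n lam env (Times a b) = ival n lam env a * ival n lam env b"

primrec arith_op :: "arith \<Rightarrow> real \<Rightarrow> real \<Rightarrow> real" where
  "arith_op Add = (+)"
| "arith_op Sub = (-)"
| "arith_op Mul = (*)"
| "arith_op Div = (/)"

text \<open>A state is the memory together with the number of steps executed so far. Every constant
  load, copy, arithmetic operation, test and loop iteration, as well as every loop entry, counts as
  one step; as the index expressions of a program have fixed size, charging for their evaluation
  would change the count by a constant factor only.

  The step number also selects the rounding error, so that the operations executed in a run have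
  independent errors. A division by a computed zero aborts the run.\<close>

type_synonym state = "(nat \<Rightarrow> real) \<times> nat"

definition tick :: "state \<Rightarrow> state" where
  "tick s = (fst s, Suc (snd s))"

primrec exec :: "nat \<Rightarrow> (nat \<Rightarrow> nat) \<Rightarrow> (nat \<Rightarrow> real) \<Rightarrow> prog \<Rightarrow> (nat \<Rightarrow> nat) \<Rightarrow> state \<Rightarrow> state option" where
  "exec n lam \<delta> (Const a k) env s =
     Some ((fst s)(ival n lam env a := real k), Suc (snd s))"
| "exec n lam \<delta> (Copy a b) env s =
     Some ((fst s)(ival n lam env a := fst s (ival n lam env b)), Suc (snd s))"
| "exec n lam \<delta> (Op f a b c) env s =
     (let y = fst s (ival n lam env b); z = fst s (ival n lam env c)
      in if f = Div \<and> z = 0 then None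
         else Some ((fst s)(ival n lam env a := arith_op f y z * (1 + \<delta> (snd s))), Suc (snd s)))"
| "exec n lam \<delta> Skip env s = Some s"
| "exec n lam \<delta> (Seq p q) env s = Option.bind (exec n lam \<delta> p env s) (exec n lam \<delta> q env)"
| "exec n lam \<delta> (IfLess a b p q) env s =
     (if ival n lam env a < ival n lam env b then exec n lam \<delta> p env (tick s)
      else exec n lam \<delta> q env (tick s))"
| "exec n lam \<delta> (For v a p) env s =
     fold (\<lambda>k r. Option.bind r (\<lambda>s'. exec n lam \<delta> p (env(v := k)) (tick s')))
       [0..<ival n lam env a] (Some (tick s))"

text \<open>The inputs are stored exactly, in cells 1, ..., n; the output is read from cell 0.\<close>

definition initial_state :: "nat \<Rightarrow> (nat \<Rightarrow> real) \<Rightarrow> state" where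
  "initial_state n x = ((\<lambda>a. if a \<in> {1..n} then x a else 0), 0)"

definition evaluates ::
  "prog \<Rightarrow> nat \<Rightarrow> (nat \<Rightarrow> nat) \<Rightarrow> (nat \<Rightarrow> real) \<Rightarrow> (nat \<Rightarrow> real) \<Rightarrow> real \<Rightarrow> nat \<Rightarrow> bool" where
  "evaluates p n lam x \<delta> out T \<longleftrightarrow>
     (\<exists>M. exec n (\<lambda>j. if j \<in> {1..n} then lam j else 0) \<delta> p (\<lambda>_. 0) (initial_state n x) = Some (M, T)
        \<and> out = M 0)"

text \<open>Relative error less than one.\<close>

definition accurate :: "real \<Rightarrow> real \<Rightarrow> bool" where
  "accurate out exact \<longleftrightarrow> \<bar>out - exact\<bar> < \<bar>exact\<bar>"

text \<open>n words for x, and the entries of \<lambda> counted by their values.\<close>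

definition input_size :: "nat \<Rightarrow> (nat \<Rightarrow> nat) \<Rightarrow> nat" where
  "input_size n lam = n + (\<Sum>j = 1..n. lam j)"

end

theory Submission
  imports Defs
begin

text \<open>Let D(k, c) be the determinant of the powers of the k largest inputs with exponents c. The
  only subtractions needed are those of two inputs. Removing the missing exponents (gaps) one after
  the other turns 0, 1, 2, ... into \<mu>. A set that contains i and m and avoids the gap g with
  i < g < m is treated by the three-term Pluecker relation
  D(J, i, m) D(J, g) = D(J, i, g) D(J, m) + D(J, g, m) D(J, i),
  which yields D(J, i, m) without subtraction from determinants that are smaller or still contain g.
  Only windows of consecutive remaining exponents occur, that is, n * n determinants for each of the
  \<lambda> 1 gaps. All divisors have size k < n, hence do not involve x 1, the only input that
  may be 0. Intervals of exponents give Vandermonde determinants times a power of the product of the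
  inputs.\<close>

section \<open>Determinants of powers\<close>

text \<open>Sums, products and quotients of positive numbers keep a bounded relative error, and so
  do differences of exact inputs; a difference of computed values may lose everything. The sign of
  every table entry is therefore part of the correctness proof, and the recursion that fills the
  table also proves it. The table is closed under the recursion because the relation singles out the
  two ends of a window: dropping the first exponent passes to row j - 1, dropping the last one to
  size k - 1. The number of gaps is \<lambda> 1 = \<mu> n - (n - 1), the count of numbers below
  \<mu> n that are not exponents. The error threshold may depend on n and \<mu>, so a very crude
  error bound, whose exponent quadruples with each step, suffices; only the cost has to be
  polynomial. The rows of \<open>power_det\<close> run through y backwards: for decreasing
  nonnegative y and increasing exponents the determinants are nonnegative without sign corrections,
  and a larger k adds a new first row.\<close>

definition power_det :: "(nat \<Rightarrow> real) \<Rightarrow> nat \<Rightarrow> (nat \<Rightarrow> nat) \<Rightarrow> real" where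
  "power_det y k c = det (mat k k (\<lambda>(i, j). y (k - Suc i) ^ c j))"

lemma power_det_cong:
  assumes "\<And>i. i < k \<Longrightarrow> c i = d i"
  shows "power_det y k c = power_det y k d"
proof -
  have "mat k k (\<lambda>(i, j). y (k - Suc i) ^ c j) = mat k k (\<lambda>(i, j). y (k - Suc i) ^ d j)"
    using assms by (intro eq_matI) auto
  then show ?thesis
    by (simp add: power_det_def)
qed

lemma det_scale_rows:
  fixes f :: "nat \<Rightarrow> nat \<Rightarrow> real"
  shows "det (mat k k (\<lambda>(i, j). d i * f i j)) = (\<Prod>i<k. d i) * det (mat k k (\<lambda>(i, j). f i j))"
proof -
  have *: "mat k k (\<lambda>(i, j). d i * f i j) = mat\<^sub>r k k (\<lambda>i. d i \<cdot>\<^sub>v vec k (f i))"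
    "mat k k (\<lambda>(i, j). f i j) = mat\<^sub>r k k (\<lambda>i. vec k (f i))"
    by (auto intro!: eq_matI)
  show ?thesis
    unfolding * by (subst det_rows_mul) (auto simp: lessThan_atLeast0)
qed

lemma power_det_shift:
  "power_det y k (\<lambda>j. a + c j) = (\<Prod>i<k. y i) ^ a * power_det y k c"
proof -
  have "power_det y k (\<lambda>j. a + c j) = (\<Prod>i<k. y (k - Suc i) ^ a) * power_det y k c"
    unfolding power_det_def power_add by (rule det_scale_rows)
  also have "(\<Prod>i<k. y (k - Suc i) ^ a) = (\<Prod>i<k. y i) ^ a"
    by (simp add: prod.nat_diff_reindex[of "\<lambda>i. y i ^ a"] prod_power_distrib)
  finally show ?thesis .
qed

text \<open>Multiplication by B subtracts \<open>y k\<close> times the preceding column from each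
  column. This clears the first row, which belongs to \<open>y k\<close>, up to its leading 1, and
  leaves a factor \<open>y i - y k\<close> in the row of \<open>y i\<close>.\<close>

lemma vandermonde_Suc:
  "power_det y (Suc k) (\<lambda>j. j) = power_det y k (\<lambda>j. j) * (\<Prod>i<k. y i - y k)"
proof -
  let ?n = "Suc k"
  define V where "V = mat ?n ?n (\<lambda>(i, j). y (?n - Suc i) ^ j)"
  define B where "B = mat ?n ?n (\<lambda>(i, j). if i = j then 1 else if Suc i = j then - y k else 0)"
  define M where "M = mat ?n ?n (\<lambda>(i, j). if j = 0 then 1 else (y (k - i) - y k) * y (k - i) ^ (j - 1))"
  have "det B = prod_list (diag_mat B)"
    by (rule det_upper_triangular[of _ ?n]) (auto simp: B_def)
  also have "\<dots> = 1"
    by (auto simp: prod_list_diag_prod B_def)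
  finally have B: "det B = 1" .
  have VB: "V * B = M"
  proof (rule eq_matI)
    fix i j
    assume "i < dim_row M" "j < dim_col M"
    then have ij: "i < ?n" "j < ?n"
      by (auto simp: M_def)
    have "(V * B) $$ (i, j) = (\<Sum>l<?n. y (k - i) ^ l * (if l = j then 1 else if Suc l = j then - y k else 0))"
      using ij by (simp add: V_def B_def scalar_prod_def lessThan_atLeast0)
    \<comment> \<open>For j = 0 the truncated \<open>j - 1\<close> is again 0, hence the inner
      conditional.\<close>
    also have "\<dots> = (\<Sum>l<?n. (if l = j then y (k - i) ^ j else 0) +
                     (if l = j - 1 then (if j = 0 then 0 else - y k * y (k - i) ^ (j - 1)) else 0))"
      by (rule sum.cong) auto
    also have "\<dots> = M $$ (i, j)"
      using ij by (cases j) (auto simp: sum.distrib M_def algebra_simps)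
    finally show "(V * B) $$ (i, j) = M $$ (i, j)" .
  qed (auto simp: V_def B_def M_def)
  have "power_det y ?n (\<lambda>j. j) = det M"
    unfolding VB[symmetric] power_det_def V_def[symmetric]
    by (subst det_mult[of _ ?n]) (auto simp: V_def B_def B[unfolded B_def])
  also have "\<dots> = (\<Sum>j<?n. M $$ (0, j) * cofactor M 0 j)"
    by (rule laplace_expansion_row) (auto simp: M_def)
  also have "\<dots> = (\<Sum>j<?n. if j = 0 then cofactor M 0 0 else 0)"
    by (rule sum.cong) (auto simp: M_def)
  also have "\<dots> = det (mat_delete M 0 0)"
    by (simp add: cofactor_def)
  also have "mat_delete M 0 0 = mat k k (\<lambda>(i, j). (y (k - Suc i) - y k) * y (k - Suc i) ^ j)"
    by (rule eq_matI) (auto simp: M_def mat_delete_def)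
  also have "det \<dots> = (\<Prod>i<k. y (k - Suc i) - y k) * power_det y k (\<lambda>j. j)"
    unfolding power_det_def by (rule det_scale_rows)
  also have "(\<Prod>i<k. y (k - Suc i) - y k) = (\<Prod>i<k. y i - y k)"
    by (rule prod.nat_diff_reindex[of "\<lambda>i. y i - y k"])
  finally show ?thesis by simp
qed

section \<open>Linear and quadratic relations between minors\<close>

definition skip :: "nat \<Rightarrow> (nat \<Rightarrow> nat) \<Rightarrow> nat \<Rightarrow> nat" where
  "skip q c j = (if j < q then c j else c (Suc j))"

text \<open>Expansion of a determinant two of whose rows are equal.\<close>

lemma power_det_relation:
  assumes "r < k"
  shows "(\<Sum>j\<le>k. y r ^ c j * ((-1) ^ j * power_det y k (skip j c))) = 0"
proof -
  let ?n = "Suc k"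
  define M where "M = mat ?n ?n (\<lambda>(i, j). (if i = 0 then y r else y (k - i)) ^ c j)"
  have "det M = 0"
  \<comment> \<open>Row i > 0 carries \<open>y (k - i)\<close>, so the second copy of
    \<open>y r\<close> is row k - r, which differs from row 0 because r < k.\<close>
  proof (rule det_identical_rows[of _ ?n 0 "k - r"])
    show "row M 0 = row M (k - r)"
      using assms by (intro eq_vecI) (auto simp: M_def)
  qed (use assms in \<open>auto simp: M_def\<close>)
  then have "0 = (\<Sum>j<?n. M $$ (0, j) * cofactor M 0 j)"
    by (subst (asm) laplace_expansion_row[of _ ?n 0]) (auto simp: M_def)
  also have "\<dots> = (\<Sum>j<?n. y r ^ c j * ((-1) ^ j * power_det y k (skip j c)))"
  proof (rule sum.cong)
    fix j
    assume "j \<in> {..<?n}"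
    moreover have "mat_delete M 0 j = mat k k (\<lambda>(i, l). y (k - Suc i) ^ skip j c l)"
      by (rule eq_matI) (auto simp: M_def mat_delete_def skip_def)
    ultimately show "M $$ (0, j) * cofactor M 0 j = y r ^ c j * ((-1) ^ j * power_det y k (skip j c))"
      by (simp add: cofactor_def power_det_def M_def)
  qed simp
  finally show ?thesis
    by (simp add: lessThan_Suc_atMost)
qed

text \<open>Signed minor with exponents b in the variables y 0, ..., y k without y r.\<close>

definition cofactor_form :: "(nat \<Rightarrow> real) \<Rightarrow> nat \<Rightarrow> (nat \<Rightarrow> nat) \<Rightarrow> nat \<Rightarrow> real" where
  "cofactor_form y k b r =
     (-1) ^ (k - r) * det (mat k k (\<lambda>(i, j). y (if i < k - r then k - i else k - Suc i) ^ b j))"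

text \<open>Laplace expansion along column p. The minors involve only the other exponents b, so for
  fixed b the determinant depends on the exponent \<open>c p\<close> through one linear form in the
  powers, up to a sign that records the position.\<close>

lemma power_det_expand:
  assumes "p \<le> k" "\<And>j. j < k \<Longrightarrow> skip p c j = b j"
  shows "power_det y (Suc k) c = (-1) ^ p * (\<Sum>r\<le>k. cofactor_form y k b r * y r ^ c p)"
proof -
  let ?n = "Suc k"
  define M where "M = mat ?n ?n (\<lambda>(i, j). y (k - i) ^ c j)"
  have "power_det y ?n c = det M"
    by (simp add: power_det_def M_def)
  also have "\<dots> = (\<Sum>i<?n. M $$ (i, p) * cofactor M i p)"
    by (rule laplace_expansion_column) (use assms in \<open>auto simp: M_def\<close>)
  also have "\<dots> = (\<Sum>i<?n. (-1) ^ p * (cofactor_form y k b (k - i) * y (k - i) ^ c p))"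
  proof (rule sum.cong)
    fix i
    assume i: "i \<in> {..<?n}"
    have "mat_delete M i p = mat k k (\<lambda>(l, j). y (if l < k - (k - i) then k - l else k - Suc l) ^ b j)"
    proof (rule eq_matI)
      fix l j
      assume lj: "l < dim_row (mat k k (\<lambda>(l, j). y (if l < k - (k - i) then k - l else k - Suc l) ^ b j))"
        "j < dim_col (mat k k (\<lambda>(l, j). y (if l < k - (k - i) then k - l else k - Suc l) ^ b j))"
      then have "b j = skip p c j"
        using assms by auto
      with lj i show "mat_delete M i p $$ (l, j) =
          mat k k (\<lambda>(l, j). y (if l < k - (k - i) then k - l else k - Suc l) ^ b j) $$ (l, j)"
        by (auto simp: M_def mat_delete_def skip_def)
    qed (auto simp: M_def)
    then show "M $$ (i, p) * cofactor M i p = (-1) ^ p * (cofactor_form y k b (k - i) * y (k - i) ^ c p)"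
      using i assms(1) by (simp add: cofactor_def cofactor_form_def M_def power_add)
  qed simp
  also have "\<dots> = (\<Sum>r<?n. (-1) ^ p * (cofactor_form y k b r * y r ^ c p))"
    using sum.nat_diff_reindex[of "\<lambda>r. (-1) ^ p * (cofactor_form y k b r * y r ^ c p)" ?n] by simp
  finally show ?thesis
    by (simp add: sum_distrib_left lessThan_Suc_atMost)
qed

text \<open>The three-term Pluecker relation. The cofactors of the common exponents (those other than the
  first, the last and the skipped one) define a linear form that vanishes at the common exponents;
  applying it to the relation between all exponents leaves three terms.\<close>

lemma power_det_three_term:
  assumes "0 < q" "q < Suc (Suc m)"
  defines "k \<equiv> Suc (Suc m)"
  shows "power_det y k (skip q c) * power_det y (Suc m) (c \<circ> Suc) =
    power_det y k c * power_det y (Suc m) (skip q c \<circ> Suc) +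
    power_det y k (c \<circ> Suc) * power_det y (Suc m) (skip q c)"
proof -
  define b where "b = skip q c \<circ> Suc"
  define \<phi> where "\<phi> e = (\<Sum>r\<le>m. cofactor_form y m b r * y r ^ e)" for e
  \<comment> \<open>Each of the three smaller determinants consists of the m exponents b and one
    more: \<open>c q\<close> in position q - 1, \<open>c k\<close> in position m, \<open>c 0\<close>
    in position 0.\<close>
  have 1: "power_det y (Suc m) (c \<circ> Suc) = (-1) ^ (q - 1) * \<phi> (c q)"
    unfolding \<phi>_def using assms by (subst power_det_expand[of "q - 1" _ _ b]) (auto simp: b_def skip_def)
  have 2: "power_det y (Suc m) (skip q c \<circ> Suc) = (-1) ^ m * \<phi> (c k)"
    unfolding \<phi>_def using assms by (subst power_det_expand[of m _ _ b]) (auto simp: b_def skip_def)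
  have 3: "power_det y (Suc m) (skip q c) = \<phi> (c 0)"
    unfolding \<phi>_def using assms by (subst power_det_expand[of 0 _ _ b]) (auto simp: b_def skip_def)
  have 4: "\<phi> (c j) = 0" if j: "j \<le> k" "j \<notin> {0, q, k}" for j
  proof -
    \<comment> \<open>The position of \<open>c j\<close> among the common exponents b, after the
      removal of index 0 and possibly of index q; then \<phi> at \<open>c j\<close> is a determinant
      with two equal columns.\<close>
    define l where "l = (if j < q then j - 1 else j - 2)"
    have l: "l < m" "b l = c j"
      using j assms Suc_diff_Suc[of 1 j] by (auto simp: l_def b_def skip_def numeral_2_eq_2)
    define d where "d i = (if i = 0 then c j else b (i - 1))" for i
    have "power_det y (Suc m) d = 0"
      unfolding power_det_def
    proof (rule det_identical_columns[of _ "Suc m" 0 "Suc l"])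
      show "col (mat (Suc m) (Suc m) (\<lambda>(i, j). y (Suc m - Suc i) ^ d j)) 0 =
        col (mat (Suc m) (Suc m) (\<lambda>(i, j). y (Suc m - Suc i) ^ d j)) (Suc l)"
        using l by (intro eq_vecI) (auto simp: d_def)
    qed (use l in auto)
    moreover have "power_det y (Suc m) d = \<phi> (c j)"
      unfolding \<phi>_def by (subst power_det_expand[of 0 _ _ b]) (auto simp: d_def skip_def)
    ultimately show ?thesis by simp
  qed
  define g where "g j = (-1) ^ j * power_det y k (skip j c)" for j
  have "(\<Sum>j\<le>k. \<phi> (c j) * g j) = (\<Sum>j\<le>k. \<Sum>r\<le>m. cofactor_form y m b r * (y r ^ c j * g j))"
    by (simp add: \<phi>_def sum_distrib_right mult.assoc)
  also have "\<dots> = (\<Sum>r\<le>m. cofactor_form y m b r * (\<Sum>j\<le>k. y r ^ c j * g j))"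
    by (subst sum.swap) (simp add: sum_distrib_left)
  also have "\<dots> = 0"
    by (rule sum.neutral) (use power_det_relation[of _ k y c] in \<open>auto simp: g_def k_def\<close>)
  finally have "0 = (\<Sum>j\<le>k. \<phi> (c j) * g j)" by simp
  also have "\<dots> = (\<Sum>j\<in>{0, q, k}. \<phi> (c j) * g j)"
    by (rule sum.mono_neutral_right) (use 4 assms in auto)
  also have "\<dots> = \<phi> (c 0) * g 0 + \<phi> (c q) * g q + \<phi> (c k) * g k"
    using assms by auto
  finally have rel: "0 = \<phi> (c 0) * g 0 + \<phi> (c q) * g q + \<phi> (c k) * g k" .
  have "skip 0 c = c \<circ> Suc"
    by (auto simp: skip_def fun_eq_iff)
  moreover have "power_det y k (skip k c) = power_det y k c"
    by (rule power_det_cong) (simp add: skip_def)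
  moreover have "(-1 :: real) ^ k = (-1) ^ m"
    by (simp add: k_def)
  moreover obtain q' where "q = Suc q'"
    using assms by (cases q) auto
  ultimately show ?thesis
    using rel unfolding 1 2 3 g_def by (simp add: algebra_simps)
qed

section \<open>Truncated exponent sequences\<close>

locale truncated_table =
  fixes n :: nat and lam :: "nat \<Rightarrow> nat" and y :: "nat \<Rightarrow> real"
  assumes n_pos: "1 \<le> n"
    and lam_antimono: "\<And>i j. 1 \<le> i \<Longrightarrow> i \<le> j \<Longrightarrow> j \<le> n \<Longrightarrow> lam j \<le> lam i"
    and y_decreasing: "\<And>i j. i < j \<Longrightarrow> j < n \<Longrightarrow> y j < y i"
    and y_nonneg: "\<And>i. i < n \<Longrightarrow> 0 \<le> y i"
begin

text \<open>With p = n + 1 - j, these are the elements number p, p + 1, ... of the set that arises from the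
  exponents \<mu> (all numbers from \<mu> n on being included) when only the first t gaps of \<mu> are kept open.\<close>

definition trunc_exp :: "nat \<Rightarrow> nat \<Rightarrow> nat \<Rightarrow> nat" where
  "trunc_exp t j i = (n - j + i) + (if i < j then min (lam (j - i)) t else t)"

text \<open>The goal is \<open>entry (lam 1) n n\<close>: all gaps are open and the window starts at
  the first exponent. Windows with k > j run past the n-th exponent.\<close>

definition entry :: "nat \<Rightarrow> nat \<Rightarrow> nat \<Rightarrow> real" where
  "entry t j k = power_det y k (trunc_exp t j)"

lemma entry_0_n: "entry 0 n k = power_det y k (\<lambda>i. i)"
  unfolding entry_def by (rule power_det_cong) (simp add: trunc_exp_def)

lemma entry_0_n_Suc: "entry 0 n (Suc k) = entry 0 n k * (\<Prod>i<k. y i - y k)"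
  unfolding entry_0_n by (rule vandermonde_Suc)

text \<open>With no open gap every window is an interval, and starting one exponent later raises all
  exponents by 1.\<close>

lemma entry_0_Suc:
  assumes "j < n"
  shows "entry 0 j k = entry 0 (Suc j) k * (\<Prod>i<k. y i)"
proof -
  have "entry 0 j k = power_det y k (\<lambda>i. 1 + trunc_exp 0 (Suc j) i)"
    unfolding entry_def using assms by (intro power_det_cong) (simp add: trunc_exp_def)
  then show ?thesis
    by (simp add: power_det_shift[of _ _ 1, simplified] entry_def)
qed

text \<open>By monotonicity of \<open>lam\<close>, t < \<open>lam j\<close> means that the new gap
  opens before the first exponent of the window, which pushes all exponents up by 1.\<close>

lemma entry_shift:
  assumes "1 \<le> j" "j \<le> n" "t < lam j"
  shows "entry (Suc t) j k = entry t j k * (\<Prod>i<k. y i)"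
proof -
  have "trunc_exp (Suc t) j i = 1 + trunc_exp t j i" for i
  proof (cases "i < j")
    case True
    then have "lam j \<le> lam (j - i)"
      using assms by (intro lam_antimono) auto
    then show ?thesis
      using assms by (simp add: trunc_exp_def)
  qed (simp add: trunc_exp_def)
  then have "entry (Suc t) j k = power_det y k (\<lambda>i. 1 + trunc_exp t j i)"
    unfolding entry_def by (intro power_det_cong) simp
  then show ?thesis
    by (simp add: power_det_shift[of _ _ 1, simplified] entry_def)
qed

text \<open>\<open>lam (j + 1 - k)\<close> belongs to the last exponent of the window; if it is at
  most t, the whole window lies below the new gap.\<close>

lemma entry_unchanged:
  assumes "1 \<le> k" "k \<le> j" "j \<le> n" "lam (j + 1 - k) \<le> t"
  shows "entry (Suc t) j k = entry t j k"
  unfolding entry_def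
proof (rule power_det_cong)
  fix i
  assume "i < k"
  then have "lam (j - i) \<le> lam (j + 1 - k)"
    using assms by (intro lam_antimono) auto
  then show "trunc_exp (Suc t) j i = trunc_exp t j i"
    using assms \<open>i < k\<close> by (simp add: trunc_exp_def)
qed

text \<open>Here the newly opened gap lies strictly between the first and the last exponent.\<close>

lemma entry_three_term:
  assumes "t < lam 1" "1 \<le> j" "j \<le> n" "lam j \<le> t" and k: "j < k \<or> t < lam (j + 1 - k)" and "1 \<le> k"
  shows "2 \<le> j" "2 \<le> k"
    "entry (Suc t) j k * entry t (j - 1) (k - 1) =
       entry t j k * entry (Suc t) (j - 1) (k - 1) + entry t (j - 1) k * entry (Suc t) j (k - 1)"
proof -
  \<comment> \<open>q is the number of window exponents below the new gap. The gap itself is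
    \<open>trunc_exp t j q\<close>, so skipping position q turns the old sequence into the new
    one.\<close>
  define q where "q = (LEAST i. j \<le> i \<or> t < lam (j - i))"
  have q: "j \<le> q \<or> t < lam (j - q)"
    unfolding q_def by (rule LeastI[of _ j]) simp
  have q_le: "q \<le> i" if "j \<le> i \<or> t < lam (j - i)" for i
    unfolding q_def using that by (rule Least_le)
  \<comment> \<open>The gap is not before the window since \<open>lam j\<close> is at most t; it is
    reached by position j - 1 since t < \<open>lam 1\<close>, and by position k - 1 by the case
    assumption.\<close>
  have "q \<noteq> 0"
    using q assms by (intro notI) auto
  moreover have "q \<le> j - 1"
    using q_le[of "j - 1"] assms by simp
  moreover have "q \<le> k - 1"
  proof (cases "j < k")
    case False
    then have "j - (k - 1) = j + 1 - k"
      using assms by simp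
    then show ?thesis
      using q_le[of "k - 1"] k False by simp
  qed (use \<open>q \<le> j - 1\<close> in simp)
  ultimately show j: "2 \<le> j" and k2: "2 \<le> k"
    by auto
  then obtain m where m: "k = Suc (Suc m)"
    by (metis add_2_eq_Suc le_Suc_ex)
  have low: "trunc_exp (Suc t) j i = trunc_exp t j i" if "i < q" for i
  proof -
    have "i < j" "lam (j - i) \<le> t"
      using that q_le[of i] by (force, force)
    then show ?thesis
      by (simp add: trunc_exp_def)
  qed
  have high: "trunc_exp t' j i = n - j + i + t'" if "q \<le> i" "t' \<le> Suc t" for i t'
  proof (cases "i < j")
    case True
    then have "lam (j - q) \<le> lam (j - i)"
      using that assms by (intro lam_antimono) auto
    then show ?thesis
      using True that q by (auto simp: trunc_exp_def)
  qed (simp add: trunc_exp_def)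
  have c': "skip q (trunc_exp t j) = trunc_exp (Suc t) j"
    by (auto simp: fun_eq_iff skip_def low high)
  have Suc_shift: "trunc_exp t' j \<circ> Suc = trunc_exp t' (j - 1)" for t'
    using assms j by (auto simp: fun_eq_iff trunc_exp_def)
  show "entry (Suc t) j k * entry t (j - 1) (k - 1) =
       entry t j k * entry (Suc t) (j - 1) (k - 1) + entry t (j - 1) k * entry (Suc t) j (k - 1)"
    using power_det_three_term[of q m y "trunc_exp t j"] \<open>q \<noteq> 0\<close> \<open>q \<le> k - 1\<close>
    unfolding entry_def c' Suc_shift by (simp add: m)
qed

section \<open>Signs of the table entries\<close>

lemma y_pos: "i < n - 1 \<Longrightarrow> 0 < y i"
  using y_decreasing[of i "n - 1"] y_nonneg[of "n - 1"] by auto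

lemma entry_0_sign:
  assumes "k \<le> n" "j \<le> n"
  shows "0 \<le> entry 0 j k" "k < n \<Longrightarrow> 0 < entry 0 j k"
proof -
  have V: "0 < entry 0 n k" using assms(1)
  proof (induction k)
    case 0
    then show ?case
      by (simp add: entry_def power_det_def)
  next
    case (Suc k)
    then show ?case
      unfolding entry_0_n_Suc by (intro mult_pos_pos prod_pos) (auto intro!: y_decreasing)
  qed
  have P: "0 \<le> (\<Prod>i<k. y i)"
    using assms by (intro prod_nonneg) (auto intro!: y_nonneg)
  \<comment> \<open>The induction descends from j = n, the Vandermonde case; each step multiplies by
    a product of inputs.\<close>
  show "0 \<le> entry 0 j k"
    using assms(2) by (induction j rule: inc_induct) (use V P entry_0_Suc in auto)
  assume "k < n"
  then have "0 < (\<Prod>i<k. y i)"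
    by (intro prod_pos) (auto intro!: y_pos)
  with assms(2) show "0 < entry 0 j k"
    by (induction j rule: inc_induct) (use V entry_0_Suc in auto)
qed

text \<open>The outer induction is over the open gaps and the inner one over the size, since the
  relation refers only to the previous level or to smaller sizes. Its divisor has size k - 1 < n and
  is strictly positive even if the smallest input vanishes.\<close>

lemma entry_sign:
  assumes "t \<le> lam 1" "1 \<le> j" "j \<le> n" "1 \<le> k" "k \<le> n"
  shows "0 \<le> entry t j k \<and> (k < n \<longrightarrow> 0 < entry t j k)"
  using assms
proof (induction t arbitrary: j k)
  case 0
  then show ?case
    using entry_0_sign by auto
next
  case (Suc t)
  note outer = Suc.IH
  from Suc.prems(4,5,2,3) show ?case
  proof (induction k arbitrary: j rule: less_induct)
    case (less k)
    have t: "t < lam 1" "t \<le> lam 1"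
      using Suc.prems(1) by auto
    note old = outer[OF t(2)]
    \<comment> \<open>The new gap lies before, beyond or inside the window; the program branches in
      the same way.\<close>
    consider (shift) "t < lam j" | (same) "k \<le> j" "lam (j + 1 - k) \<le> t"
      | (three) "lam j \<le> t" "j < k \<or> t < lam (j + 1 - k)"
      by linarith
    then show ?case
    proof cases
      case shift
      have "0 \<le> (\<Prod>i<k. y i)" "k < n \<longrightarrow> 0 < (\<Prod>i<k. y i)"
        using less.prems by (auto intro!: prod_nonneg prod_pos y_nonneg y_pos)
      then show ?thesis
        using old[of j k] less.prems shift by (auto simp: entry_shift)
    next
      case same
      then show ?thesis
        using old[of j k] less.prems by (simp add: entry_unchanged)
    next
      case three
      note rel = entry_three_term[OF t(1) less.prems(3,4) three less.prems(1)]
      have d: "0 < entry t (j - 1) (k - 1)"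
        using old[of "j - 1" "k - 1"] less.prems rel by auto
      have n1: "0 < entry (Suc t) (j - 1) (k - 1)" and n2: "0 < entry (Suc t) j (k - 1)"
        using less.IH[of "k - 1" "j - 1"] less.IH[of "k - 1" j] less.prems rel by auto
      have o: "0 \<le> entry t j k" "0 \<le> entry t (j - 1) k"
        "k < n \<longrightarrow> 0 < entry t j k" "k < n \<longrightarrow> 0 < entry t (j - 1) k"
        using old[of j k] old[of "j - 1" k] less.prems rel by auto
      have "entry (Suc t) j k = (entry t j k * entry (Suc t) (j - 1) (k - 1)
          + entry t (j - 1) k * entry (Suc t) j (k - 1)) / entry t (j - 1) (k - 1)"
        using rel(3) d by (simp add: field_simps)
      then show ?thesis
        using d n1 n2 o by (auto intro!: divide_nonneg_pos divide_pos_pos add_nonneg_nonneg add_pos_pos)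
    qed
  qed
qed

end

section \<open>The determinant and the Schur function\<close>

lemma strict_mono_on_ge:
  fixes \<mu> :: "nat \<Rightarrow> nat"
  assumes "strict_mono_on {1..n} \<mu>" "1 \<le> i" "i \<le> j" "j \<le> n"
  shows "\<mu> i + (j - i) \<le> \<mu> j"
  using assms(3,4)
proof (induction j rule: dec_induct)
  case (step j)
  then have "\<mu> j < \<mu> (Suc j)"
    using assms by (auto intro!: strict_mono_onD[OF assms(1)])
  with step show ?case by simp
qed simp

lemma partition_of_antimono:
  assumes "strict_mono_on {1..n} \<mu>" "1 \<le> i" "i \<le> j" "j \<le> n"
  shows "partition_of n \<mu> j \<le> partition_of n \<mu> i"
proof -
  have "\<mu> (n + 1 - j) + ((n + 1 - i) - (n + 1 - j)) \<le> \<mu> (n + 1 - i)"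
    by (rule strict_mono_on_ge[OF assms(1)]) (use assms(2-) in linarith)+
  then show ?thesis
    using assms(2-) unfolding partition_of_def by linarith
qed

lemma partition_of_exponent:
  assumes "strict_mono_on {1..n} \<mu>" "1 \<le> j" "j \<le> n"
  shows "partition_of n \<mu> j + (n - j) = \<mu> (n + 1 - j)"
proof -
  have "\<mu> 1 + ((n + 1 - j) - 1) \<le> \<mu> (n + 1 - j)"
    by (rule strict_mono_on_ge[OF assms(1)]) (use assms(2-) in linarith)+
  then show ?thesis
    using assms(2-) unfolding partition_of_def by linarith
qed

lemma det_gen_vandermonde_eq:
  "det (gen_vandermonde n \<mu> x) = power_det (\<lambda>r. x (n - r)) n (\<lambda>i. \<mu> (Suc i))"
proof -
  have "gen_vandermonde n \<mu> x = mat n n (\<lambda>(i, j). x (n - (n - Suc i)) ^ \<mu> (Suc j))"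
    unfolding gen_vandermonde_def by (rule eq_matI) auto
  then show ?thesis
    by (simp add: power_det_def)
qed

text \<open>The factor s is the determinant of the reversal matrix R and does not depend on f. Its
  value never has to be computed, because it cancels in a quotient; R * R = 1 shows that it is
  nonzero.\<close>

lemma det_reverse_columns:
  obtains s :: real where "s \<noteq> 0"
    "\<And>f :: nat \<Rightarrow> nat \<Rightarrow> real. det (mat n n (\<lambda>(i, j). f i (n - Suc j))) = det (mat n n (\<lambda>(i, j). f i j)) * s"
proof (rule that)
  define R :: "real mat" where "R = mat n n (\<lambda>(i, j). if i = n - Suc j then 1 else 0)"
  have mult: "mat n n (\<lambda>(i, j). f i j) * R = mat n n (\<lambda>(i, j). f i (n - Suc j))"
    for f :: "nat \<Rightarrow> nat \<Rightarrow> real"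
  proof (rule eq_matI)
    fix i j
    assume "i < dim_row (mat n n (\<lambda>(i, j). f i (n - Suc j)))" "j < dim_col (mat n n (\<lambda>(i, j). f i (n - Suc j)))"
    then have ij: "i < n" "j < n"
      by auto
    then have "(mat n n (\<lambda>(i, j). f i j) * R) $$ (i, j) = (\<Sum>l<n. f i l * (if l = n - Suc j then 1 else 0))"
      by (simp add: R_def scalar_prod_def lessThan_atLeast0)
    also have "\<dots> = (\<Sum>l<n. if l = n - Suc j then f i (n - Suc j) else 0)"
      by (rule sum.cong) auto
    finally show "(mat n n (\<lambda>(i, j). f i j) * R) $$ (i, j) = mat n n (\<lambda>(i, j). f i (n - Suc j)) $$ (i, j)"
      using ij by simp
  qed (auto simp: R_def)
  show "det (mat n n (\<lambda>(i, j). f i (n - Suc j))) = det (mat n n (\<lambda>(i, j). f i j)) * det R"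
    for f :: "nat \<Rightarrow> nat \<Rightarrow> real"
    unfolding mult[symmetric] by (rule det_mult[of _ n]) (auto simp: R_def)
  have "R * R = 1\<^sub>m n"
  proof -
    have "R * R = mat n n (\<lambda>(i, j). if i = n - Suc (n - Suc j) then 1 else 0)"
      using mult[of "\<lambda>i j. if i = n - Suc j then 1 else 0"] by (simp add: R_def)
    also have "\<dots> = 1\<^sub>m n"
      by (rule eq_matI) auto
    finally show ?thesis .
  qed
  then have "det R * det R = 1"
    using det_mult[of R n R] by (simp add: R_def)
  then show "det R \<noteq> 0" by auto
qed

text \<open>The induction adds inputs from the largest index downwards: the new
  \<open>x (n - k)\<close> has the smallest index and supplies the first factor of every inner
  product.\<close>

lemma det_vandermonde_eq:
  "k \<le> n \<Longrightarrow> power_det (\<lambda>r. x (n - r)) k (\<lambda>i. i) = (\<Prod>j = n - k + 1..n. \<Prod>i = n - k + 1..<j. x j - x i)"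
proof (induction k)
  case 0
  then show ?case by (simp add: power_det_def)
next
  case (Suc k)
  define a where "a = n - Suc k + 1"
  have a: "a = n - k" "1 \<le> a" "Suc (n - Suc k) = n - k"
    using Suc.prems by (auto simp: a_def)
  \<comment> \<open>For j = a the inner product is empty.\<close>
  have "(\<Prod>j = a..n. \<Prod>i = a..<j. x j - x i) = (\<Prod>j = Suc a..n. \<Prod>i = a..<j. x j - x i)"
    using a Suc.prems by (subst prod.atLeast_Suc_atMost) auto
  also have "\<dots> = (\<Prod>j = Suc a..n. (x j - x a) * (\<Prod>i = Suc a..<j. x j - x i))"
    by (rule prod.cong) (auto simp: prod.atLeast_Suc_lessThan)
  also have "\<dots> = (\<Prod>j = Suc a..n. x j - x a) * (\<Prod>j = Suc a..n. \<Prod>i = Suc a..<j. x j - x i)"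
    by (rule prod.distrib)
  also have "(\<Prod>j = Suc a..n. x j - x a) = (\<Prod>i<k. x (n - i) - x (n - k))"
    by (rule prod.reindex_bij_witness[of _ "\<lambda>i. n - i" "\<lambda>j. n - j"]) (use a Suc.prems in auto)
  finally show ?case
    using Suc a by (simp add: vandermonde_Suc a_def[symmetric] mult.commute)
qed

text \<open>Both determinants of the bialternant quotient have decreasing exponents. Reversing their
  columns gives the determinant of the generalized matrix and the Vandermonde determinant, with the
  same sign factor.\<close>

lemma det_eq_schur:
  assumes "strict_mono_on {1..n} \<mu>" and x: "\<And>i j. 1 \<le> i \<Longrightarrow> i < j \<Longrightarrow> j \<le> n \<Longrightarrow> x i < x j"
  shows "det (gen_vandermonde n \<mu> x) =
    (\<Prod>j = 1..n. \<Prod>i = 1..<j. x j - x i) * schur n (partition_of n \<mu>) x"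
proof -
  let ?V = "det (mat n n (\<lambda>(i, j). x (Suc i) ^ j))"
  obtain s :: real where s: "s \<noteq> 0" "\<And>f :: nat \<Rightarrow> nat \<Rightarrow> real.
      det (mat n n (\<lambda>(i, j). f i (n - Suc j))) = det (mat n n (\<lambda>(i, j). f i j)) * s"
    by (rule det_reverse_columns[of n]) (rule that)
  have "mat n n (\<lambda>(i, j). x (Suc i) ^ (partition_of n \<mu> (Suc j) + (n - Suc j)))
      = mat n n (\<lambda>(i, j). x (Suc i) ^ \<mu> (Suc (n - Suc j)))"
  proof (rule eq_matI)
    fix i j
    assume "i < dim_row (mat n n (\<lambda>(i, j). x (Suc i) ^ \<mu> (Suc (n - Suc j))))"
      "j < dim_col (mat n n (\<lambda>(i, j). x (Suc i) ^ \<mu> (Suc (n - Suc j))))"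
    then show "mat n n (\<lambda>(i, j). x (Suc i) ^ (partition_of n \<mu> (Suc j) + (n - Suc j))) $$ (i, j)
        = mat n n (\<lambda>(i, j). x (Suc i) ^ \<mu> (Suc (n - Suc j))) $$ (i, j)"
      using partition_of_exponent[OF assms(1), of "Suc j"] by (auto simp: Suc_diff_Suc)
  qed auto
  then have "schur n (partition_of n \<mu>) x = det (gen_vandermonde n \<mu> x) * s / (?V * s)"
    unfolding schur_def gen_vandermonde_def
    using s(2)[of "\<lambda>i j. x (Suc i) ^ \<mu> (Suc j)"] s(2)[of "\<lambda>i j. x (Suc i) ^ j"] by simp
  moreover have "mat n n (\<lambda>(i, j). x (Suc i) ^ j) = mat n n (\<lambda>(i, j). x (n - (n - Suc i)) ^ j)"
    by (rule eq_matI) auto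
  then have "?V = (\<Prod>j = 1..n. \<Prod>i = 1..<j. x j - x i)"
    using det_vandermonde_eq[of n n x] by (simp add: power_det_def)
  moreover have "(\<Prod>j = 1..n. \<Prod>i = 1..<j. x j - x i) \<noteq> 0"
    using x by (force simp: prod_zero_iff)
  ultimately show ?thesis
    using s(1) by simp
qed

section \<open>Consequences of total positivity\<close>

lemma pick_pair:
  assumes "i < i'"
  shows "pick {i, i'} 0 = i" "pick {i, i'} (Suc 0) = i'"
proof -
  have *: "{a \<in> {i, i'}. a < i} = {}" "{a \<in> {i, i'}. a < i'} = {i}"
    using assms by auto
  show "pick {i, i'} 0 = i" "pick {i, i'} (Suc 0) = i'"
    using pick_card_in_set[of i "{i, i'}"] pick_card_in_set[of i' "{i, i'}"]
    unfolding * by (simp_all del: pick.simps)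
qed

lemma det_mat_2:
  fixes f :: "nat \<Rightarrow> nat \<Rightarrow> real"
  shows "det (mat 2 2 (\<lambda>(i, j). f i j)) = f 0 0 * f 1 1 - f 0 1 * f 1 0"
  by (subst laplace_expansion_row[of _ 2 0])
    (auto simp: numeral_2_eq_2 cofactor_def mat_delete_def det_single)

lemma det_submatrix_pair:
  fixes A :: "real mat"
  assumes "i < i'" "i' < dim_row A" "j < j'" "j' < dim_col A"
  shows "det (submatrix A {i, i'} {j, j'}) = A $$ (i, j) * A $$ (i', j') - A $$ (i, j') * A $$ (i', j)"
proof -
  have "{a. a < dim_row A \<and> a \<in> {i, i'}} = {i, i'}" "{a. a < dim_col A \<and> a \<in> {j, j'}} = {j, j'}"
    using assms by auto
  then have "submatrix A {i, i'} {j, j'} = mat 2 2 (\<lambda>(a, b). A $$ (pick {i, i'} a, pick {j, j'} b))"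
    using assms by (simp add: submatrix_def numeral_2_eq_2)
  moreover have "pick {i, i'} 0 = i" "pick {i, i'} (Suc 0) = i'" "pick {j, j'} 0 = j" "pick {j, j'} (Suc 0) = j'"
    using pick_pair assms by auto
  ultimately show ?thesis
    by (simp add: det_mat_2 del: pick.simps)
qed

lemma submatrix_all: "submatrix A {..<dim_row A} {..<dim_col A} = A"
proof -
  have "pick {..<m} i = i" if "i < m" for m i
  proof -
    have "{a \<in> {..<m}. a < i} = {..<i}"
      using that by auto
    then show ?thesis
      using pick_card_in_set[of i "{..<m}"] that by simp
  qed
  moreover have "{a. a < m \<and> a \<in> {..<m}} = {..<m}" for m :: nat
    by auto
  ultimately show ?thesis
    by (intro eq_matI) (auto simp: submatrix_def)
qed

lemma totally_positive_det:
  assumes "totally_positive (gen_vandermonde n \<mu> x)" "1 \<le> n"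
  shows "0 < det (gen_vandermonde n \<mu> x)"
proof -
  let ?G = "gen_vandermonde n \<mu> x"
  have "0 < det (submatrix ?G {..<dim_row ?G} {..<dim_col ?G})"
    using assms(1)[unfolded totally_positive_def, rule_format, of "{..<n}" "{..<n}"] assms(2)
    by (simp add: gen_vandermonde_def lessThan_empty_iff)
  then show ?thesis
    by (simp only: submatrix_all)
qed

text \<open>With d = \<mu> 2 - \<mu> 1 the minor in rows i, j and the first two columns is
  \<open>(x i * x j) ^ \<mu> 1 * (x j ^ d - x i ^ d)\<close>; its positivity excludes x j \<le> x i
  for nonnegative inputs.\<close>

lemma totally_positive_increasing:
  assumes tp: "totally_positive (gen_vandermonde n \<mu> x)" and \<mu>: "strict_mono_on {1..n} \<mu>"
    and nonneg: "\<And>i. i \<in> {1..n} \<Longrightarrow> 0 \<le> x i" and ij: "1 \<le> i" "i < j" "j \<le> n"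
  shows "x i < x j"
proof (rule ccontr)
  let ?G = "gen_vandermonde n \<mu> x"
  assume "\<not> x i < x j"
  have "\<mu> 1 < \<mu> 2"
    using ij by (intro strict_mono_onD[OF \<mu>]) auto
  then obtain d where d: "\<mu> 2 = \<mu> 1 + d"
    using le_Suc_ex[of "\<mu> 1" "\<mu> 2"] by auto
  have "x j ^ d \<le> x i ^ d"
    using \<open>\<not> x i < x j\<close> nonneg[of j] ij by (intro power_mono) auto
  then have "(x i * x j) ^ \<mu> 1 * x j ^ d \<le> (x i * x j) ^ \<mu> 1 * x i ^ d"
    using nonneg[of i] nonneg[of j] ij by (intro mult_left_mono) auto
  moreover have "0 < det (submatrix ?G {i - 1, j - 1} {0, 1})"
    using tp[unfolded totally_positive_def, rule_format, of "{i - 1, j - 1}" "{0, 1}"] ij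
    by (force simp: gen_vandermonde_def)
  moreover have "det (submatrix ?G {i - 1, j - 1} {0, 1}) = x i ^ \<mu> 1 * x j ^ \<mu> 2 - x i ^ \<mu> 2 * x j ^ \<mu> 1"
    using ij by (subst det_submatrix_pair) (auto simp: gen_vandermonde_def numeral_2_eq_2)
  ultimately show False
    by (simp add: d power_add power_mult_distrib algebra_simps)
qed

section \<open>Relative errors\<close>

text \<open>The multiplicative form is symmetric under inversion, and factors simply multiply under
  products. An exact value 0 forces the computed value to be 0.\<close>

definition near :: "real \<Rightarrow> real \<Rightarrow> real \<Rightarrow> bool" where
  "near R a e \<longleftrightarrow> 0 \<le> e \<and> e / R \<le> a \<and> a \<le> e * R"

lemma near_refl: "1 \<le> R \<Longrightarrow> 0 \<le> e \<Longrightarrow> near R e e"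
  using mult_left_mono[of 1 R e] unfolding near_def by (simp add: pos_divide_le_eq)

lemma near_nonneg: "near R a e \<Longrightarrow> 1 \<le> R \<Longrightarrow> 0 \<le> a"
  unfolding near_def by (meson divide_nonneg_nonneg order_trans zero_le_one)

lemma near_mono:
  assumes "near R a e" "1 \<le> R" "R \<le> S"
  shows "near S a e"
proof -
  have "e / S \<le> e / R" "e * R \<le> e * S"
    using assms by (auto simp: near_def intro!: divide_left_mono mult_left_mono)
  then show ?thesis
    using assms by (auto simp: near_def)
qed

text \<open>Both exact values are nonnegative, so nothing cancels and the factor does not
  grow.\<close>

lemma near_add:
  assumes "near R a e" "near R b f"
  shows "near R (a + b) (e + f)"
proof -
  have "0 \<le> e + f" "(e + f) / R \<le> a + b" "a + b \<le> (e + f) * R"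
    using assms unfolding near_def add_divide_distrib distrib_right by linarith+
  then show ?thesis
    unfolding near_def by simp
qed

lemma near_mult:
  assumes "near R a e" "near S b f" "1 \<le> R" "1 \<le> S"
  shows "near (R * S) (a * b) (e * f)"
proof -
  have "e / R * (f / S) \<le> a * b"
    using assms by (intro mult_mono near_nonneg[of R a]) (auto simp: near_def)
  moreover have "a * b \<le> (e * R) * (f * S)"
    using assms by (intro mult_mono near_nonneg[of S b]) (auto simp: near_def)
  ultimately show ?thesis
    using assms by (auto simp: near_def ac_simps)
qed

lemma near_pos:
  assumes "near R a e" "1 \<le> R" "0 < e"
  shows "0 < a"
proof -
  have "0 < e / R"
    using assms by simp
  also have "e / R \<le> a"
    using assms by (simp add: near_def)
  finally show ?thesis .
qed

lemma near_inverse: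
  assumes "near R a e" "1 \<le> R" "0 < e"
  shows "near R (inverse a) (inverse e)"
proof -
  have "0 < a"
    using near_pos assms by blast
  moreover have "e \<le> a * R" "a \<le> e * R"
    using assms by (auto simp: near_def field_simps)
  ultimately show ?thesis
    using assms by (auto simp: near_def field_simps)
qed

section \<open>A program logic that tracks rounding errors and step counts\<close>

locale rounded_run = truncated_table n lam "\<lambda>r. x (n - r)"
  for n lam and x :: "nat \<Rightarrow> real" +
  fixes \<delta> :: "nat \<Rightarrow> real" and \<rho> :: real
  assumes \<rho>: "1 \<le> \<rho>" and \<delta>: "\<And>t. 1 / \<rho> \<le> 1 + \<delta> t" "\<And>t. 1 + \<delta> t \<le> \<rho>"
begin

text \<open>The step number alone bounds the error factor: an operation combines two values of factor
  err T and a rounding of factor \<rho> \<le> err T, so the factor grows to at most err T ^ 3 \<le> err (T + 1).\<close>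

definition err :: "nat \<Rightarrow> real" where
  "err T = \<rho> ^ (4 ^ T)"

lemma err_ge_1: "1 \<le> err T"
  unfolding err_def using \<rho> by simp

lemma err_mono: "T \<le> T' \<Longrightarrow> err T \<le> err T'"
  unfolding err_def using \<rho> by (intro power_increasing) auto

lemma err_Suc: "err (Suc T) = err T * err T * err T * err T"
proof -
  have "(4 :: nat) ^ Suc T = 4 ^ T + 4 ^ T + 4 ^ T + 4 ^ T"
    by simp
  then show ?thesis
    unfolding err_def power_add[symmetric] by (rule arg_cong)
qed

lemma near_rounding: "near (err T) (1 + \<delta> t) 1"
proof -
  have "\<rho> \<le> err T"
    unfolding err_def using \<rho> power_increasing[of 1 "4 ^ T" \<rho>] by simp
  then show ?thesis
    using near_mono[of \<rho> "1 + \<delta> t" 1 "err T"] \<delta> \<rho> by (auto simp: near_def)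
qed

lemma near_rounded:
  assumes "near (err T * err T) a e"
  shows "near (err (Suc T)) (a * (1 + \<delta> t)) e"
proof -
  have 1: "1 \<le> err T * err T"
    using err_ge_1[of T] mult_mono[of 1 "err T" 1 "err T"] by simp
  have "near (err T * err T * err T) (a * (1 + \<delta> t)) e"
    using near_mult[OF assms near_rounding[of T t] 1 err_ge_1] by simp
  moreover have 2: "1 \<le> err T * err T * err T"
    using mult_mono[OF 1 err_ge_1[of T]] 1 by simp
  moreover have "err T * err T * err T \<le> err (Suc T)"
    using mult_left_mono[OF err_ge_1[of T], of "err T * err T * err T"] 2 by (simp add: err_Suc)
  ultimately show ?thesis
    by (rule near_mono)
qed

definition inputs :: "(nat \<times> real) set" where
  "inputs = (\<lambda>i. (i, x i)) ` {1..n}"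

text \<open>The inputs stay exact in every state, which makes their differences harmless. All other
  known cells share one error factor determined by the current step number, so no individual error
  bounds are carried along.\<close>

definition sat :: "(nat \<times> real) set \<Rightarrow> state \<Rightarrow> bool" where
  "sat A s \<longleftrightarrow> (\<forall>i\<in>{1..n}. fst s i = x i) \<and> (\<forall>(a, e)\<in>A. near (err (snd s)) (fst s a) e)"

text \<open>Total correctness: the run does not abort, and it adds at most T steps.\<close>

definition hoare :: "(nat \<times> real) set \<Rightarrow> prog \<Rightarrow> (nat \<Rightarrow> nat) \<Rightarrow> nat \<Rightarrow> (nat \<times> real) set \<Rightarrow> bool" where
  "hoare A p env T B \<longleftrightarrow> (\<forall>s. sat A s \<longrightarrow>
     (\<exists>s'. exec n lam \<delta> p env s = Some s' \<and> sat B s' \<and> snd s' \<le> snd s + T))"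

text \<open>Everything known about the cell a before the write is forgotten.\<close>

definition put :: "(nat \<times> real) set \<Rightarrow> nat \<Rightarrow> real \<Rightarrow> (nat \<times> real) set" where
  "put A a e = insert (a, e) {z \<in> A. fst z \<noteq> a}"

lemma x_nonneg: "i \<in> {1..n} \<Longrightarrow> 0 \<le> x i"
  using y_nonneg[of "n - i"] by auto

lemma sat_read:
  assumes "sat A s" "(a, e) \<in> A \<union> inputs"
  shows "near (err (snd s)) (fst s a) e"
proof (cases "(a, e) \<in> A")
  case True
  then show ?thesis
    using assms(1) by (auto simp: sat_def)
next
  case False
  then show ?thesis
    using assms near_refl[OF err_ge_1 x_nonneg[of a], of "snd s"] by (auto simp: sat_def inputs_def)
qed

lemma sat_later:
  assumes "sat A s" "snd s \<le> T" "B \<subseteq> A"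
  shows "sat B (fst s, T)"
proof -
  have "near (err T) (fst s a) e" if "(a, e) \<in> B" for a e
    by (rule near_mono[OF _ err_ge_1 err_mono[OF assms(2)]]) (use that assms in \<open>auto simp: sat_def\<close>)
  then show ?thesis
    using assms(1) by (auto simp: sat_def)
qed

lemma sat_put:
  assumes "sat A s" "a \<notin> {1..n}" "near (err (Suc (snd s))) v e" "B \<subseteq> put A a e"
  shows "sat B ((fst s)(a := v), Suc (snd s))"
proof -
  have "sat A (fst s, Suc (snd s))"
    by (rule sat_later) (use assms in auto)
  then show ?thesis
    using assms by (fastforce simp: sat_def put_def)
qed

lemma hoare_Const:
  assumes "ival n lam env a \<notin> {1..n}" "B \<subseteq> put A (ival n lam env a) (real k)"
  shows "hoare A (Const a k) env 1 B"
  unfolding hoare_def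
proof (intro allI impI)
  fix s
  assume s: "sat A s"
  from sat_put[OF s assms(1) near_refl[OF err_ge_1] assms(2)]
  show "\<exists>s'. exec n lam \<delta> (Const a k) env s = Some s' \<and> sat B s' \<and> snd s' \<le> snd s + 1"
    by simp
qed

lemma hoare_Copy:
  assumes "(ival n lam env b, e) \<in> A \<union> inputs"
    and "ival n lam env a \<notin> {1..n}" "B \<subseteq> put A (ival n lam env a) e"
  shows "hoare A (Copy a b) env 1 B"
  unfolding hoare_def
proof (intro allI impI)
  fix s
  assume s: "sat A s"
  have "near (err (Suc (snd s))) (fst s (ival n lam env b)) e"
    using near_mono[OF sat_read[OF s assms(1)] err_ge_1 err_mono] by simp
  from sat_put[OF s assms(2) this assms(3)]
  show "\<exists>s'. exec n lam \<delta> (Copy a b) env s = Some s' \<and> sat B s' \<and> snd s' \<le> snd s + 1"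
    by simp
qed

lemma hoare_Op:
  assumes "\<And>s. sat A s \<Longrightarrow> \<not> (f = Div \<and> fst s (ival n lam env c) = 0) \<and>
      near (err (snd s) * err (snd s)) (arith_op f (fst s (ival n lam env b)) (fst s (ival n lam env c))) e"
    and "ival n lam env a \<notin> {1..n}" "B \<subseteq> put A (ival n lam env a) e"
  shows "hoare A (Op f a b c) env 1 B"
  unfolding hoare_def
proof (intro allI impI)
  fix s
  assume s: "sat A s"
  note * = assms(1)[OF s]
  from sat_put[OF s assms(2) near_rounded[OF *[THEN conjunct2], of "snd s"] assms(3)] *
  show "\<exists>s'. exec n lam \<delta> (Op f a b c) env s = Some s' \<and> sat B s' \<and> snd s' \<le> snd s + 1"
    by (auto simp: Let_def)
qed

lemma hoare_Mul:
  assumes "(ival n lam env b, e) \<in> A \<union> inputs" "(ival n lam env c, f) \<in> A \<union> inputs"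
    and "ival n lam env a \<notin> {1..n}" "B \<subseteq> put A (ival n lam env a) (e * f)"
  shows "hoare A (Op Mul a b c) env 1 B"
proof (rule hoare_Op[OF _ assms(3,4)])
  fix s
  assume "sat A s"
  from sat_read[OF this assms(1)] sat_read[OF this assms(2)]
  show "\<not> (Mul = Div \<and> fst s (ival n lam env c) = 0) \<and>
      near (err (snd s) * err (snd s)) (arith_op Mul (fst s (ival n lam env b)) (fst s (ival n lam env c))) (e * f)"
    using near_mult err_ge_1 by simp
qed

text \<open>Positivity of the exact divisor passes to the computed one, so the run cannot abort
  here.\<close>

lemma hoare_Div:
  assumes "(ival n lam env b, e) \<in> A \<union> inputs" "(ival n lam env c, f) \<in> A \<union> inputs" "0 < f"
    and "ival n lam env a \<notin> {1..n}" "B \<subseteq> put A (ival n lam env a) (e / f)"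
  shows "hoare A (Op Div a b c) env 1 B"
proof (rule hoare_Op[OF _ assms(4,5)])
  fix s
  assume "sat A s"
  note * = sat_read[OF this assms(1)] sat_read[OF this assms(2)]
  show "\<not> (Div = Div \<and> fst s (ival n lam env c) = 0) \<and>
      near (err (snd s) * err (snd s)) (arith_op Div (fst s (ival n lam env b)) (fst s (ival n lam env c))) (e / f)"
    using near_pos[OF *(2) err_ge_1 assms(3)]
      near_mult[OF *(1) near_inverse[OF *(2) err_ge_1 assms(3)] err_ge_1 err_ge_1]
    by (simp add: divide_inverse)
qed

lemma near_err_twice: "near (err T) a e \<Longrightarrow> near (err T * err T) a e"
proof (erule near_mono[OF _ err_ge_1])
  show "err T \<le> err T * err T"
    using mult_left_mono[OF err_ge_1[of T], of "err T"] err_ge_1[of T] by simp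
qed

lemma hoare_Add:
  assumes "(ival n lam env b, e) \<in> A \<union> inputs" "(ival n lam env c, f) \<in> A \<union> inputs"
    and "ival n lam env a \<notin> {1..n}" "B \<subseteq> put A (ival n lam env a) (e + f)"
  shows "hoare A (Op Add a b c) env 1 B"
proof (rule hoare_Op[OF _ assms(3,4)])
  fix s
  assume "sat A s"
  from sat_read[OF this assms(1)] sat_read[OF this assms(2)]
  show "\<not> (Add = Div \<and> fst s (ival n lam env c) = 0) \<and>
      near (err (snd s) * err (snd s)) (arith_op Add (fst s (ival n lam env b)) (fst s (ival n lam env c))) (e + f)"
    using near_err_twice[OF near_add] by simp
qed

text \<open>The operands are exact, so the rounding of the result is the only error.\<close>

lemma hoare_Sub_inputs:
  assumes "ival n lam env b = i" "ival n lam env c = j" "i \<in> {1..n}" "j \<in> {1..n}" "x j \<le> x i"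
    and "ival n lam env a \<notin> {1..n}" "B \<subseteq> put A (ival n lam env a) (x i - x j)"
  shows "hoare A (Op Sub a b c) env 1 B"
proof (rule hoare_Op[OF _ assms(6,7)])
  fix s
  assume "sat A s"
  then show "\<not> (Sub = Div \<and> fst s (ival n lam env c) = 0) \<and>
      near (err (snd s) * err (snd s)) (arith_op Sub (fst s (ival n lam env b)) (fst s (ival n lam env c))) (x i - x j)"
    using near_err_twice[OF near_refl[OF err_ge_1, of "x i - x j"]] assms(1-5) by (simp add: sat_def)
qed

lemma hoareE:
  assumes "hoare A p env T B" "sat A s"
  obtains s' where "exec n lam \<delta> p env s = Some s'" "sat B s'" "snd s' \<le> snd s + T"
proof -
  have "sat A s \<longrightarrow> (\<exists>s'. exec n lam \<delta> p env s = Some s' \<and> sat B s' \<and> snd s' \<le> snd s + T)"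
    using assms(1) unfolding hoare_def by (rule spec)
  from mp[OF this assms(2)] show thesis
    using that by meson
qed

lemma hoare_Seq:
  assumes "hoare A p env T B" "hoare B q env U C"
  shows "hoare A (Seq p q) env (T + U) C"
  unfolding hoare_def
proof (intro allI impI)
  fix s
  assume "sat A s"
  with assms(1) obtain s' where s': "exec n lam \<delta> p env s = Some s'" "sat B s'" "snd s' \<le> snd s + T"
    by (rule hoareE)
  from assms(2) s'(2) obtain s''
    where "exec n lam \<delta> q env s' = Some s''" "sat C s''" "snd s'' \<le> snd s' + U"
    by (rule hoareE)
  with s' show "\<exists>s'. exec n lam \<delta> (Seq p q) env s = Some s' \<and> sat C s' \<and> snd s' \<le> snd s + (T + U)"
    by (intro exI[of _ s'']) simp
qed

lemma hoare_weaken: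
  assumes "hoare A p env T B" "A \<subseteq> A'" "B' \<subseteq> B" "T \<le> T'"
  shows "hoare A' p env T' B'"
  unfolding hoare_def
proof (intro allI impI)
  fix s
  assume "sat A' s"
  then have "sat A s"
    using assms(2) unfolding sat_def by blast
  with assms(1) obtain s' where s': "exec n lam \<delta> p env s = Some s'" "sat B s'" "snd s' \<le> snd s + T"
    by (rule hoareE)
  moreover have "sat B' s'"
    using s'(2) assms(3) unfolding sat_def by blast
  ultimately show "\<exists>s'. exec n lam \<delta> p env s = Some s' \<and> sat B' s' \<and> snd s' \<le> snd s + T'"
    using assms(4) by (intro exI[of _ s']) simp
qed

lemma sat_tick: "sat A s \<Longrightarrow> sat A (tick s)"
  unfolding tick_def by (rule sat_later) auto

lemma hoare_IfLess:
  assumes "ival n lam env a < ival n lam env b \<Longrightarrow> hoare A p env T B"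
    and "\<not> ival n lam env a < ival n lam env b \<Longrightarrow> hoare A q env T B"
  shows "hoare A (IfLess a b p q) env (T + 1) B"
  unfolding hoare_def
proof (intro allI impI)
  fix s
  assume "sat A s"
  then have t: "sat A (tick s)"
    by (rule sat_tick)
  show "\<exists>s'. exec n lam \<delta> (IfLess a b p q) env s = Some s' \<and> sat B s' \<and> snd s' \<le> snd s + (T + 1)"
  proof (cases "ival n lam env a < ival n lam env b")
    case True
    then show ?thesis
      using assms(1)[OF True, unfolded hoare_def, rule_format, OF t] by (simp add: tick_def)
  next
    case False
    then show ?thesis
      using assms(2)[OF False, unfolded hoare_def, rule_format, OF t] by (simp add: tick_def)
  qed
qed

text \<open>The invariant may vary with the counter. The leading 1 pays for the loop entry, the one
  in T + 1 for each iteration.\<close>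

lemma hoare_For:
  assumes "ival n lam env a = m" and "\<And>k. k < m \<Longrightarrow> hoare (A k) p (env(v := k)) T (A (Suc k))"
  shows "hoare (A 0) (For v a p) env (1 + m * (T + 1)) (A m)"
  unfolding hoare_def
proof (intro allI impI)
  fix s
  assume s: "sat (A 0) s"
  define body where "body k s = exec n lam \<delta> p (env(v := k)) (tick s)" for k s
  have "k \<le> m \<Longrightarrow> \<exists>s'. fold (\<lambda>k r. Option.bind r (body k)) [0..<k] (Some (tick s)) = Some s' \<and>
      sat (A k) s' \<and> snd s' \<le> snd s + (1 + k * (T + 1))" for k
  proof (induction k)
    case 0
    then show ?case
      using sat_tick[OF s] by (simp add: tick_def)
  next
    case (Suc k)
    have "k \<le> m"
      using Suc.prems by simp
    from Suc.IH[OF this] obtain s'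
      where s': "fold (\<lambda>k r. Option.bind r (body k)) [0..<k] (Some (tick s)) = Some s'"
        "sat (A k) s'" "snd s' \<le> snd s + (1 + k * (T + 1))"
      by blast
    have "hoare (A k) p (env(v := k)) T (A (Suc k))"
      using assms(2) Suc.prems by simp
    from this sat_tick[OF s'(2)] obtain s''
      where "body k s' = Some s''" "sat (A (Suc k)) s''" "snd s'' \<le> snd (tick s') + T"
      unfolding body_def by (rule hoareE)
    with s' show ?case
      by (intro exI[of _ s'']) (simp add: tick_def)
  qed
  from this[of m] assms(1)
  show "\<exists>s'. exec n lam \<delta> (For v a p) env s = Some s' \<and> sat (A m) s' \<and> snd s' \<le> snd s + (1 + m * (T + 1))"
    unfolding body_def by simp
qed

end

section \<open>The program\<close>

text \<open>Memory layout after the inputs: the products of the k last inputs, two scratch cells, the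
  table of all entry t j k.\<close>

definition prod_cell :: "idx \<Rightarrow> idx" where
  "prod_cell k = Plus (Plus Size (Lit 1)) k"

definition scratch_cell :: "nat \<Rightarrow> idx" where
  "scratch_cell i = Plus (Plus Size Size) (Lit (2 + i))"

definition entry_cell :: "idx \<Rightarrow> idx \<Rightarrow> idx \<Rightarrow> idx" where
  "entry_cell t j k = Plus (Plus (Plus Size Size) (Lit 4))
     (Plus (Times (Plus (Times t (Plus Size (Lit 1))) j) (Plus Size (Lit 1))) k)"

abbreviation Succ :: "idx \<Rightarrow> idx" where
  "Succ a \<equiv> Plus a (Lit 1)"

text \<open>Cell n - k holds the largest input not yet multiplied.\<close>

definition products_prog :: prog where
  "products_prog = Seq (Const (prod_cell (Lit 0)) 1)
     (For 0 Size (Op Mul (prod_cell (Succ (Var 0))) (prod_cell (Var 0)) (Minus Size (Var 0))))"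

definition vandermonde_prog :: prog where
  "vandermonde_prog =
     (let V = entry_cell (Lit 0) Size in
      Seq (Const (V (Lit 0)) 1)
     (For 0 Size
       (Seq (Copy (V (Succ (Var 0))) (V (Var 0)))
       (For 1 (Var 0)
         (Seq (Op Sub (scratch_cell 0) (Minus Size (Var 1)) (Minus Size (Var 0)))
              (Op Mul (V (Succ (Var 0))) (V (Succ (Var 0))) (scratch_cell 0)))))))"

text \<open>Rows are filled downwards from row n, which holds the Vandermonde determinants.\<close>

definition first_level_prog :: prog where
  "first_level_prog =
     For 0 Size
       (For 1 (Minus Size (Lit 1))
         (Op Mul (entry_cell (Lit 0) (Minus (Minus Size (Lit 1)) (Var 1)) (Succ (Var 0)))
            (entry_cell (Lit 0) (Minus Size (Var 1)) (Succ (Var 0)))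
            (prod_cell (Succ (Var 0)))))"

text \<open>Loop counters start at 0, so j and k are one less than the row and the size of the new entry.\<close>

definition three_term_prog :: "idx \<Rightarrow> idx \<Rightarrow> idx \<Rightarrow> prog" where
  "three_term_prog t j k =
     Seq (Op Mul (scratch_cell 0) (entry_cell t (Succ j) (Succ k)) (entry_cell (Succ t) j k))
    (Seq (Op Mul (scratch_cell 1) (entry_cell t j (Succ k)) (entry_cell (Succ t) (Succ j) k))
    (Seq (Op Add (scratch_cell 0) (scratch_cell 0) (scratch_cell 1))
         (Op Div (entry_cell (Succ t) (Succ j) (Succ k)) (scratch_cell 0) (entry_cell t j k))))"

text \<open>The test of j against k catches windows that run past the n-th exponent. There the index
  \<open>Minus (Succ j) k\<close> truncates to 0 and names no part of \<lambda>.\<close>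

definition step_prog :: "idx \<Rightarrow> idx \<Rightarrow> idx \<Rightarrow> prog" where
  "step_prog t j k =
     (let old = entry_cell t (Succ j) (Succ k); new = entry_cell (Succ t) (Succ j) (Succ k) in
      IfLess t (Lam (Succ j)) (Op Mul new old (prod_cell (Succ k)))
     (IfLess j k (three_term_prog t j k)
     (IfLess t (Lam (Minus (Succ j) k)) (three_term_prog t j k)
       (Copy new old))))"

text \<open>The size loop encloses the row loop because the relation uses entries of the new level
  of the next smaller size, in two rows.\<close>

definition levels_prog :: prog where
  "levels_prog = For 0 (Lam (Lit 1)) (For 1 Size (For 2 Size (step_prog (Var 0) (Var 2) (Var 1))))"

definition det_prog :: prog where
  "det_prog = Seq products_prog (Seq vandermonde_prog (Seq first_level_prog (Seq levels_prog
     (Copy (Lit 0) (entry_cell (Lam (Lit 1)) Size Size)))))"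

section \<open>Correctness and cost of the program\<close>

context rounded_run
begin

abbreviation y :: "nat \<Rightarrow> real" where
  "y r \<equiv> x (n - r)"

definition prod_addr :: "nat \<Rightarrow> nat" where
  "prod_addr k = n + 1 + k"

definition scratch_addr :: "nat \<Rightarrow> nat" where
  "scratch_addr i = n + n + (2 + i)"

definition entry_addr :: "nat \<Rightarrow> nat \<Rightarrow> nat \<Rightarrow> nat" where
  "entry_addr t j k = n + n + 4 + ((t * (n + 1) + j) * (n + 1) + k)"

lemma ival_cells [simp]:
  "ival n lam env (prod_cell k) = prod_addr (ival n lam env k)"
  "ival n lam env (scratch_cell i) = scratch_addr i"
  "ival n lam env (entry_cell t j k) = entry_addr (ival n lam env t) (ival n lam env j) (ival n lam env k)"
  by (simp_all add: prod_cell_def prod_addr_def scratch_cell_def scratch_addr_def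
      entry_cell_def entry_addr_def)

lemma not_input [simp]: "\<not> prod_addr k \<le> n" "\<not> scratch_addr i \<le> n" "\<not> entry_addr t j k \<le> n"
  by (simp_all add: prod_addr_def scratch_addr_def entry_addr_def)

lemma digits_unique:
  fixes a b c d m :: nat
  assumes "a * m + b = c * m + d" "b < m" "d < m"
  shows "a = c \<and> b = d"
  using assms by (metis add.commute div_mult_self1 div_less mod_mult_self1 mod_less add_cancel_right_left not_less_zero)

lemma entry_addr_inj:
  assumes "j \<le> n" "k \<le> n" "j' \<le> n" "k' \<le> n"
  shows "entry_addr t j k = entry_addr t' j' k' \<longleftrightarrow> t = t' \<and> j = j' \<and> k = k'"
  using digits_unique[of "t * (n + 1) + j" "n + 1" k "t' * (n + 1) + j'" k']
    digits_unique[of t "n + 1" j t' j'] assms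
  unfolding entry_addr_def by auto

definition products :: "nat \<Rightarrow> (nat \<times> real) set" where
  "products m = (\<lambda>k. (prod_addr k, \<Prod>i<k. y i)) ` {..m}"

definition entries :: "(nat \<times> nat \<times> nat) set \<Rightarrow> (nat \<times> real) set" where
  "entries S = (\<lambda>(t, j, k). (entry_addr t j k, entry t j k)) ` S"

abbreviation state_set :: "(nat \<times> nat \<times> nat) set \<Rightarrow> (nat \<times> real) set" where
  "state_set S \<equiv> products n \<union> entries S"

lemma products_mem: "k \<le> m \<Longrightarrow> (prod_addr k, \<Prod>i<k. y i) \<in> products m"
  unfolding products_def by auto

lemma entries_mem: "(t, j, k) \<in> S \<Longrightarrow> (entry_addr t j k, entry t j k) \<in> entries S"
  unfolding entries_def by force

lemma entries_insert: "entries (insert (t, j, k) S) = insert (entry_addr t j k, entry t j k) (entries S)"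
  unfolding entries_def by simp

lemma state_set_mono: "S \<subseteq> S' \<Longrightarrow> state_set S \<subseteq> state_set S'"
  unfolding entries_def by blast

text \<open>The range on which addresses are distinct: j and k are digits in base n + 1, and t is
  the unbounded leading part.\<close>

definition grid :: "(nat \<times> nat \<times> nat) set" where
  "grid = {(t, j, k). j \<le> n \<and> k \<le> n}"

text \<open>A frame rule: writing one entry disturbs neither the products nor the other entries. The
  additional facts X may be dropped.\<close>

lemma put_entry:
  assumes "S \<subseteq> insert (t, j, k) S'" "S' \<subseteq> grid" "j \<le> n" "k \<le> n"
  shows "state_set S \<subseteq> put (state_set S' \<union> X) (entry_addr t j k) (entry t j k)"
proof -
  have "products n \<subseteq> put (state_set S' \<union> X) (entry_addr t j k) (entry t j k)"
    by (auto simp: products_def put_def prod_addr_def entry_addr_def)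
  moreover have "entries S \<subseteq> put (state_set S' \<union> X) (entry_addr t j k) (entry t j k)"
  proof
    fix z
    assume "z \<in> entries S"
    then obtain t' j' k' where z: "z = (entry_addr t' j' k', entry t' j' k')" "(t', j', k') \<in> S"
      by (auto simp: entries_def)
    show "z \<in> put (state_set S' \<union> X) (entry_addr t j k) (entry t j k)"
    proof (cases "(t', j', k') = (t, j, k)")
      case False
      then have S': "(t', j', k') \<in> S'"
        using z(2) assms(1) by auto
      then have "entry_addr t' j' k' \<noteq> entry_addr t j k"
        using entry_addr_inj[of j' k' j k t' t] assms False by (auto simp: grid_def)
      then show ?thesis
        using z(1) entries_mem[OF S'] by (auto simp: put_def)
    qed (simp add: z(1) put_def)
  qed
  ultimately show ?thesis
    by simp
qed

text \<open>The products end at address 2 n + 1 and the table begins at 2 n + 4, which leaves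
  exactly two scratch cells.\<close>

lemma put_scratch:
  assumes "i < 2" "X \<subseteq> put X' (scratch_addr i) e"
  shows "state_set S \<union> X \<subseteq> put (state_set S \<union> X') (scratch_addr i) e"
proof -
  have "fst z \<noteq> scratch_addr i" if "z \<in> state_set S" for z
    using that assms(1)
    by (auto simp: products_def entries_def prod_addr_def scratch_addr_def entry_addr_def)
  then show ?thesis
    using assms(2) unfolding put_def by blast
qed

lemma hoare_products: "hoare {} products_prog env (2 * n + 2) (products n)"
proof -
  have "hoare {} products_prog env (1 + (1 + n * (1 + 1))) (products n)"
    unfolding products_prog_def
  proof (rule hoare_Seq)
    show "hoare {} (Const (prod_cell (Lit 0)) 1) env 1 (products 0)"
      by (rule hoare_Const) (auto simp: products_def put_def prod_addr_def)
    show "hoare (products 0) (For 0 Size (Op Mul (prod_cell (Succ (Var 0))) (prod_cell (Var 0)) (Minus Size (Var 0))))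
      env (1 + n * (1 + 1)) (products n)"
    proof (rule hoare_For)
      fix k
      assume k: "k < n"
      show "hoare (products k) (Op Mul (prod_cell (Succ (Var 0))) (prod_cell (Var 0)) (Minus Size (Var 0)))
        (env(0 := k)) 1 (products (Suc k))"
        by (rule hoare_Mul[of _ _ "\<Prod>i<k. y i" _ _ "y k"])
          (use k in \<open>auto simp: products_mem inputs_def products_def put_def prod_addr_def le_Suc_eq\<close>)
    qed simp
  qed
  then show ?thesis
    by (rule hoare_weaken) auto
qed

lemma hoare_vandermonde:
  "hoare (products n) vandermonde_prog env (2 + n * (3 + 3 * n)) (state_set {(0, n, k) | k. k \<le> n})"
proof -
  let ?S = "\<lambda>m. {(0, n, k) | k. k \<le> m}"
  let ?V = "entry_cell (Lit 0) Size"
  have "hoare (products n) vandermonde_prog env (1 + (1 + n * ((1 + (1 + n * ((1 + 1) + 1))) + 1)))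
    (state_set (?S n))"
    unfolding vandermonde_prog_def Let_def
  proof (rule hoare_Seq)
    show "hoare (products n) (Const (?V (Lit 0)) 1) env 1 (state_set (?S 0))"
    proof (rule hoare_Const)
      have "entry 0 n 0 = real 1"
        by (simp add: entry_def power_det_def)
      then show "state_set (?S 0) \<subseteq> put (products n) (ival n lam env (?V (Lit 0))) (real 1)"
        using put_entry[of "?S 0" 0 n 0 "{}" "{}"] by (auto simp: entries_def)
    qed simp
    show "hoare (state_set (?S 0)) (For 0 Size
       (Seq (Copy (?V (Succ (Var 0))) (?V (Var 0)))
       (For 1 (Var 0)
         (Seq (Op Sub (scratch_cell 0) (Minus Size (Var 1)) (Minus Size (Var 0)))
              (Op Mul (?V (Succ (Var 0))) (?V (Succ (Var 0))) (scratch_cell 0)))))) env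
       (1 + n * ((1 + (1 + n * ((1 + 1) + 1))) + 1)) (state_set (?S n))"
    proof (rule hoare_For)
      fix k
      assume k: "k < n"
      define env' where "env' = env(0 := k)"
      \<comment> \<open>The cell of the new entry serves as accumulator; after k factors it holds
        the Vandermonde determinant of size k + 1.\<close>
      define acc where "acc m = state_set (?S k) \<union> {(entry_addr 0 n (Suc k), entry 0 n k * (\<Prod>i<m. y i - y k))}" for m
      have new: "entry_addr 0 n k' \<noteq> entry_addr 0 n (Suc k)" if "k' \<le> k" for k'
        using that k entry_addr_inj[of n k' n "Suc k" 0 0] by auto
      have fresh: "fst z \<noteq> entry_addr 0 n (Suc k)" if "z \<in> state_set (?S k)" for z
        using that new by (auto simp: products_def entries_def) (simp add: prod_addr_def entry_addr_def)
      have acc_put: "acc m \<subseteq> put (acc m' \<union> X) (entry_addr 0 n (Suc k)) (entry 0 n k * (\<Prod>i<m. y i - y k))"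
        for m m' X
        using fresh unfolding acc_def put_def by blast
      have acc_put': "acc m \<subseteq> put (state_set (?S k)) (entry_addr 0 n (Suc k)) (entry 0 n k * (\<Prod>i<m. y i - y k))"
        for m
        using fresh unfolding acc_def put_def by blast
      have "hoare (state_set (?S k)) (Seq (Copy (?V (Succ (Var 0))) (?V (Var 0)))
       (For 1 (Var 0)
         (Seq (Op Sub (scratch_cell 0) (Minus Size (Var 1)) (Minus Size (Var 0)))
              (Op Mul (?V (Succ (Var 0))) (?V (Succ (Var 0))) (scratch_cell 0))))) env'
          (1 + (1 + k * ((1 + 1) + 1))) (acc k)"
      proof (rule hoare_Seq)
        show "hoare (state_set (?S k)) (Copy (?V (Succ (Var 0))) (?V (Var 0))) env' 1 (acc 0)"
          by (rule hoare_Copy[of _ _ "entry 0 n k"])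
            (use acc_put'[of 0] entries_mem[of 0 n k "?S k"] in \<open>auto simp: env'_def\<close>)
        show "hoare (acc 0) (For 1 (Var 0)
         (Seq (Op Sub (scratch_cell 0) (Minus Size (Var 1)) (Minus Size (Var 0)))
              (Op Mul (?V (Succ (Var 0))) (?V (Succ (Var 0))) (scratch_cell 0)))) env'
            (1 + k * ((1 + 1) + 1)) (acc k)"
        proof (rule hoare_For)
          fix i
          assume i: "i < k"
          show "hoare (acc i)
           (Seq (Op Sub (scratch_cell 0) (Minus Size (Var 1)) (Minus Size (Var 0)))
              (Op Mul (?V (Succ (Var 0))) (?V (Succ (Var 0))) (scratch_cell 0))) (env'(1 := i)) (1 + 1) (acc (Suc i))"
          proof (rule hoare_Seq)
            show "hoare (acc i) (Op Sub (scratch_cell 0) (Minus Size (Var 1)) (Minus Size (Var 0)))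
              (env'(1 := i)) 1 (acc i \<union> {(scratch_addr 0, y i - y k)})"
            proof (rule hoare_Sub_inputs)
              show "y k \<le> y i"
                using y_decreasing[OF i k] by simp
              have "fst z \<noteq> scratch_addr 0" if "z \<in> acc i" for z
                using that
                by (auto simp: acc_def products_def entries_def prod_addr_def scratch_addr_def entry_addr_def)
              then show "acc i \<union> {(scratch_addr 0, y i - y k)} \<subseteq>
                put (acc i) (ival n lam (env'(1 := i)) (scratch_cell 0)) (y i - y k)"
                unfolding put_def ival_cells by blast
            qed (use i k in \<open>auto simp: env'_def\<close>)
            show "hoare (acc i \<union> {(scratch_addr 0, y i - y k)})
              (Op Mul (?V (Succ (Var 0))) (?V (Succ (Var 0))) (scratch_cell 0)) (env'(1 := i)) 1 (acc (Suc i))"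
              by (rule hoare_Mul[of _ _ "entry 0 n k * (\<Prod>i<i. y i - y k)" _ _ "y i - y k"])
                (use acc_put[of "Suc i" i "{(scratch_addr 0, y i - y k)}"] in
                  \<open>auto simp: env'_def acc_def mult.assoc\<close>)
          qed
        qed (simp add: env'_def)
      qed
      moreover have "?S (Suc k) \<subseteq> insert (0, n, Suc k) (?S k)"
        by (auto simp: le_Suc_eq)
      then have "state_set (?S (Suc k)) \<subseteq> acc k"
        using state_set_mono[of "?S (Suc k)" "insert (0, n, Suc k) (?S k)"]
        unfolding acc_def entry_0_n_Suc[symmetric] entries_insert by blast
      ultimately show "hoare (state_set (?S k)) (Seq (Copy (?V (Succ (Var 0))) (?V (Var 0)))
       (For 1 (Var 0)
         (Seq (Op Sub (scratch_cell 0) (Minus Size (Var 1)) (Minus Size (Var 0)))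
              (Op Mul (?V (Succ (Var 0))) (?V (Succ (Var 0))) (scratch_cell 0))))) (env(0 := k))
          (1 + (1 + n * ((1 + 1) + 1))) (state_set (?S (Suc k)))"
        unfolding env'_def[symmetric] by (rule hoare_weaken[OF _ order_refl]) (use k in auto)
    qed simp
  qed
  then show ?thesis
    by (rule hoare_weaken) (auto simp: algebra_simps)
qed

abbreviation level :: "nat \<Rightarrow> (nat \<times> nat \<times> nat) set" where
  "level t \<equiv> {(t, j, k) | j k. 1 \<le> j \<and> j \<le> n \<and> 1 \<le> k \<and> k \<le> n}"

lemma hoare_first_level:
  "hoare (state_set {(0, n, k) | k. k \<le> n}) first_level_prog env (1 + n * (2 + 2 * n)) (state_set (level 0))"
proof -
  let ?V = "{(0, n, k) | k. k \<le> n}"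
  let ?S = "\<lambda>m. ?V \<union> {(0, j, k) | j k. 1 \<le> j \<and> j \<le> n \<and> 1 \<le> k \<and> k \<le> m}"
  let ?p = "Op Mul (entry_cell (Lit 0) (Minus (Minus Size (Lit 1)) (Var 1)) (Succ (Var 0)))
            (entry_cell (Lit 0) (Minus Size (Var 1)) (Succ (Var 0)))
            (prod_cell (Succ (Var 0)))"
  have "hoare (state_set (?S 0)) first_level_prog env (1 + n * ((1 + (n - 1) * (1 + 1)) + 1)) (state_set (?S n))"
    unfolding first_level_prog_def
  proof (rule hoare_For)
    fix k
    assume k: "k < n"
    let ?S' = "\<lambda>m. ?S k \<union> {(0, j, Suc k) | j. 1 \<le> j \<and> n - m \<le> j \<and> j \<le> n}"
    have "hoare (state_set (?S' 0)) (For 1 (Minus Size (Lit 1)) ?p) (env(0 := k))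
      (1 + (n - 1) * (1 + 1)) (state_set (?S' (n - 1)))"
    proof (rule hoare_For)
      fix m
      assume m: "m < n - 1"
      have e: "entry 0 (n - 1 - m) (Suc k) = entry 0 (n - m) (Suc k) * (\<Prod>i<Suc k. y i)"
        using entry_0_Suc[of "n - 1 - m" "Suc k"] m by (simp add: Suc_diff_Suc)
      have "n - m \<le> j \<or> j = n - 1 - m" if "n - Suc m \<le> j" for j
        using that by linarith
      then have "?S' (Suc m) \<subseteq> insert (0, n - 1 - m, Suc k) (?S' m)"
        by fastforce
      then have put: "state_set (?S' (Suc m)) \<subseteq> put (state_set (?S' m) \<union> {}) (entry_addr 0 (n - 1 - m) (Suc k))
          (entry 0 (n - 1 - m) (Suc k))"
        by (rule put_entry) (use k in \<open>auto simp: grid_def\<close>)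
      show "hoare (state_set (?S' m)) ?p (env(0 := k, 1 := m)) 1 (state_set (?S' (Suc m)))"
      proof (rule hoare_Mul)
        show "(ival n lam (env(0 := k, 1 := m)) (entry_cell (Lit 0) (Minus Size (Var 1)) (Succ (Var 0))),
            entry 0 (n - m) (Suc k)) \<in> state_set (?S' m) \<union> inputs"
        proof -
          have "1 \<le> n - m"
            using m by linarith
          then have "(0, n - m, Suc k) \<in> ?S' m"
            by simp
          from entries_mem[OF this] show ?thesis
            by simp
        qed
        show "(ival n lam (env(0 := k, 1 := m)) (prod_cell (Succ (Var 0))), \<Prod>i<Suc k. y i)
            \<in> state_set (?S' m) \<union> inputs"
          using products_mem[of "Suc k" n] k by simp
      qed (use put e in auto)
    qed simp
    \<comment> \<open>For m = 0 the only row is n, already present as a Vandermonde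
      determinant.\<close>
    moreover have "?S' 0 \<subseteq> ?S k"
      using k by auto
    then have "state_set (?S' 0) \<subseteq> state_set (?S k)"
      by (rule state_set_mono)
    moreover have "?S (Suc k) \<subseteq> ?S' (n - 1)"
      by (auto simp: le_Suc_eq)
    then have "state_set (?S (Suc k)) \<subseteq> state_set (?S' (n - 1))"
      by (rule state_set_mono)
    ultimately show "hoare (state_set (?S k)) (For 1 (Minus Size (Lit 1)) ?p) (env(0 := k))
      (1 + (n - 1) * (1 + 1)) (state_set (?S (Suc k)))"
      by (rule hoare_weaken[OF _ _ _ order_refl])
  qed simp
  then show ?thesis
  proof (rule hoare_weaken)
    have "level 0 \<subseteq> ?S n"
      by auto
    then show "state_set (level 0) \<subseteq> state_set (?S n)"
      by (rule state_set_mono)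
    have "?S 0 \<subseteq> ?V" by auto
    then show "state_set (?S 0) \<subseteq> state_set ?V"
      by (rule state_set_mono)
    have "1 + (n - 1) * (1 + 1) + 1 \<le> 2 + 2 * n"
      by simp
    then show "1 + n * ((1 + (n - 1) * (1 + 1)) + 1) \<le> 1 + n * (2 + 2 * n)"
      by (intro add_left_mono mult_left_mono) auto
  qed
qed

lemma scratch_addr_neq: "scratch_addr 0 \<noteq> scratch_addr (Suc 0)"
  by (simp add: scratch_addr_def)

lemma hoare_three_term:
  assumes idx: "ival n lam env t = a" "ival n lam env j = b" "ival n lam env k = c"
    and S: "(a, Suc b, Suc c) \<in> S" "(Suc a, b, c) \<in> S" "(a, b, Suc c) \<in> S" "(Suc a, Suc b, c) \<in> S"
      "(a, b, c) \<in> S"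
    and bounds: "S \<subseteq> grid" "S' \<subseteq> insert (Suc a, Suc b, Suc c) S" "b < n" "c < n"
    and rel: "entry (Suc a) (Suc b) (Suc c) * entry a b c =
      entry a (Suc b) (Suc c) * entry (Suc a) b c + entry a b (Suc c) * entry (Suc a) (Suc b) c"
    and pos: "0 < entry a b c"
  shows "hoare (state_set S) (three_term_prog t j k) env 4 (state_set S')"
proof -
  define u v where "u = entry a (Suc b) (Suc c) * entry (Suc a) b c"
    and "v = entry a b (Suc c) * entry (Suc a) (Suc b) c"
  let ?X = "{(scratch_addr 0, u)}" and ?Y = "{(scratch_addr 0, u), (scratch_addr 1, v)}"
    and ?Z = "{(scratch_addr 0, u + v)}"
  have "hoare (state_set S) (three_term_prog t j k) env (1 + (1 + (1 + 1))) (state_set S')"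
    unfolding three_term_prog_def
  proof (intro hoare_Seq)
    show "hoare (state_set S) (Op Mul (scratch_cell 0) (entry_cell t (Succ j) (Succ k)) (entry_cell (Succ t) j k))
        env 1 (state_set S \<union> ?X)"
      by (rule hoare_Mul[of _ _ "entry a (Suc b) (Suc c)" _ _ "entry (Suc a) b c"])
        (use entries_mem[OF S(1)] entries_mem[OF S(2)] put_scratch[of 0 ?X "{}" u S] in
          \<open>auto simp: idx u_def[symmetric] put_def\<close>)
    show "hoare (state_set S \<union> ?X) (Op Mul (scratch_cell 1) (entry_cell t j (Succ k)) (entry_cell (Succ t) (Succ j) k))
        env 1 (state_set S \<union> ?Y)"
      by (rule hoare_Mul[of _ _ "entry a b (Suc c)" _ _ "entry (Suc a) (Suc b) c"])
        (use entries_mem[OF S(3)] entries_mem[OF S(4)] put_scratch[of 1 ?Y ?X v S] scratch_addr_neq in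
          \<open>auto simp: idx v_def[symmetric] put_def\<close>)
    show "hoare (state_set S \<union> ?Y) (Op Add (scratch_cell 0) (scratch_cell 0) (scratch_cell 1))
        env 1 (state_set S \<union> ?Z)"
      by (rule hoare_Add[of _ _ u _ _ v]) (use put_scratch[of 0 ?Z ?Y "u + v" S] in \<open>auto simp: put_def\<close>)
    have e: "(u + v) / entry a b c = entry (Suc a) (Suc b) (Suc c)"
      using rel pos by (simp add: u_def v_def field_simps)
    show "hoare (state_set S \<union> ?Z) (Op Div (entry_cell (Succ t) (Succ j) (Succ k)) (scratch_cell 0) (entry_cell t j k))
        env 1 (state_set S')"
    proof (rule hoare_Div[OF _ _ pos])
      show "state_set S' \<subseteq> put (state_set S \<union> ?Z)
          (ival n lam env (entry_cell (Succ t) (Succ j) (Succ k))) ((u + v) / entry a b c)"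
        unfolding e using put_entry[of S' "Suc a" "Suc b" "Suc c" S ?Z] bounds by (simp add: idx)
    qed (use entries_mem[OF S(5)] in \<open>auto simp: idx\<close>)
  qed
  then show ?thesis
    by (rule hoare_weaken) auto
qed

text \<open>The second assumption on S says that size c is complete on the new level; size 0 is not
  tabulated for it, which is consistent because the relation occurs only for sizes at least
  2.\<close>

lemma hoare_step:
  assumes idx: "ival n lam env t = a" "ival n lam env j = b" "ival n lam env k = c"
    and S: "level a \<subseteq> S" "\<And>b'. 1 \<le> b' \<Longrightarrow> b' \<le> n \<Longrightarrow> 1 \<le> c \<Longrightarrow> (Suc a, b', c) \<in> S" "S \<subseteq> grid"
    and bounds: "S' \<subseteq> insert (Suc a, Suc b, Suc c) S" "a < lam 1" "b < n" "c < n"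
  shows "hoare (state_set S) (step_prog t j k) env 7 (state_set S')"
proof -
  have old: "(entry_addr a (Suc b) (Suc c), entry a (Suc b) (Suc c)) \<in> entries S"
    using S(1) bounds by (intro entries_mem) auto
  have put: "state_set S' \<subseteq> put (state_set S) (entry_addr (Suc a) (Suc b) (Suc c)) (entry (Suc a) (Suc b) (Suc c))"
    using put_entry[of S' "Suc a" "Suc b" "Suc c" S "{}"] S bounds by simp
  have three: "hoare (state_set S) (three_term_prog t j k) env 4 (state_set S')"
    if "lam (Suc b) \<le> a" "b < c \<or> a < lam (Suc b - c)"
  proof -
    have cond: "Suc b < Suc c \<or> a < lam (Suc b + 1 - Suc c)"
      using that(2) by auto
    note rel = entry_three_term[of a "Suc b" "Suc c", OF bounds(2) _ _ that(1) cond]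
    \<comment> \<open>This puts the divisor \<open>entry a b c\<close> into the tabulated range; its
      size c < n makes it positive.\<close>
    have bc: "1 \<le> b" "1 \<le> c"
      using rel(1,2) bounds by auto
    show ?thesis
    proof (rule hoare_three_term[OF idx])
      show "0 < entry a b c"
        using entry_sign[of a b c] bounds bc by auto
      show "entry (Suc a) (Suc b) (Suc c) * entry a b c =
        entry a (Suc b) (Suc c) * entry (Suc a) b c + entry a b (Suc c) * entry (Suc a) (Suc b) c"
        using rel(3) bounds by simp
    qed (use S bounds bc in auto)
  qed
  \<comment> \<open>Three nested tests on top of the four operations of the longest branch.\<close>
  have "hoare (state_set S) (step_prog t j k) env (((4 + 1) + 1) + 1) (state_set S')"
    unfolding step_prog_def Let_def
  proof (intro hoare_IfLess)
    assume "ival n lam env t < ival n lam env (Lam (Succ j))"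
    then have "entry (Suc a) (Suc b) (Suc c) = entry a (Suc b) (Suc c) * (\<Prod>i<Suc c. y i)"
      using bounds by (intro entry_shift) (auto simp: idx)
    then have "hoare (state_set S)
       (Op Mul (entry_cell (Succ t) (Succ j) (Succ k)) (entry_cell t (Succ j) (Succ k)) (prod_cell (Succ k))) env 1
       (state_set S')"
      by (intro hoare_Mul[of _ _ "entry a (Suc b) (Suc c)" _ _ "\<Prod>i<Suc c. y i"])
        (use old put products_mem[of "Suc c" n] bounds in \<open>simp_all add: idx\<close>)
    then show "hoare (state_set S)
       (Op Mul (entry_cell (Succ t) (Succ j) (Succ k)) (entry_cell t (Succ j) (Succ k)) (prod_cell (Succ k))) env
       ((4 + 1) + 1) (state_set S')"
      by (rule hoare_weaken) auto
  next
    assume "\<not> ival n lam env t < ival n lam env (Lam (Succ j))" "ival n lam env j < ival n lam env k"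
    then show "hoare (state_set S) (three_term_prog t j k) env (4 + 1) (state_set S')"
      by (intro hoare_weaken[OF three]) (auto simp: idx)
  next
    assume "\<not> ival n lam env t < ival n lam env (Lam (Succ j))" "\<not> ival n lam env j < ival n lam env k"
      "ival n lam env t < ival n lam env (Lam (Minus (Succ j) k))"
    then show "hoare (state_set S) (three_term_prog t j k) env 4 (state_set S')"
      by (intro three) (auto simp: idx)
  next
    assume "\<not> ival n lam env t < ival n lam env (Lam (Succ j))" "\<not> ival n lam env j < ival n lam env k"
      "\<not> ival n lam env t < ival n lam env (Lam (Minus (Succ j) k))"
    then have "entry (Suc a) (Suc b) (Suc c) = entry a (Suc b) (Suc c)"
      using bounds by (intro entry_unchanged) (auto simp: idx)
    then have "hoare (state_set S) (Copy (entry_cell (Succ t) (Succ j) (Succ k)) (entry_cell t (Succ j) (Succ k))) env 1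
       (state_set S')"
      by (intro hoare_Copy[of _ _ "entry a (Suc b) (Suc c)"]) (use old put in \<open>simp_all add: idx\<close>)
    then show "hoare (state_set S) (Copy (entry_cell (Succ t) (Succ j) (Succ k)) (entry_cell t (Succ j) (Succ k))) env 4
       (state_set S')"
      by (rule hoare_weaken) auto
  qed
  then show ?thesis
    by (rule hoare_weaken) auto
qed

lemma hoare_levels:
  "hoare (state_set (level 0)) levels_prog env (1 + lam 1 * (2 + n * (2 + n * 8))) (state_set (level (lam 1)))"
proof -
  have "hoare (state_set (level 0)) levels_prog env
      (1 + lam 1 * ((1 + n * ((1 + n * (7 + 1)) + 1)) + 1)) (state_set (level (lam 1)))"
    unfolding levels_prog_def
  proof (rule hoare_For)
    fix t
    assume t: "t < lam 1"
    let ?S = "\<lambda>c. level t \<union> {(Suc t, j, k) | j k. 1 \<le> j \<and> j \<le> n \<and> 1 \<le> k \<and> k \<le> c}"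
    have "hoare (state_set (?S 0)) (For 1 Size (For 2 Size (step_prog (Var 0) (Var 2) (Var 1)))) (env(0 := t))
        (1 + n * ((1 + n * (7 + 1)) + 1)) (state_set (?S n))"
    proof (rule hoare_For)
      fix c
      assume c: "c < n"
      let ?T = "\<lambda>b. ?S c \<union> {(Suc t, j, Suc c) | j. 1 \<le> j \<and> j \<le> b}"
      have "hoare (state_set (?T 0)) (For 2 Size (step_prog (Var 0) (Var 2) (Var 1))) (env(0 := t, 1 := c))
        (1 + n * (7 + 1)) (state_set (?T n))"
      proof (rule hoare_For)
        fix b
        assume b: "b < n"
        show "hoare (state_set (?T b)) (step_prog (Var 0) (Var 2) (Var 1)) (env(0 := t, 1 := c, 2 := b)) 7
            (state_set (?T (Suc b)))"
          by (rule hoare_step[of _ _ t _ b _ c]) (use t b c in \<open>auto simp: grid_def le_Suc_eq\<close>)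
      qed simp
      moreover have "?S c \<supseteq> ?T 0" "?S (Suc c) \<subseteq> ?T n"
        by (auto simp: le_Suc_eq)
      ultimately show "hoare (state_set (?S c)) (For 2 Size (step_prog (Var 0) (Var 2) (Var 1))) (env(0 := t, 1 := c))
        (1 + n * (7 + 1)) (state_set (?S (Suc c)))"
        by (rule hoare_weaken[OF _ state_set_mono state_set_mono order_refl])
    qed simp
    moreover have "level t \<supseteq> ?S 0" "level (Suc t) \<subseteq> ?S n"
      by auto
    ultimately show "hoare (state_set (level t)) (For 1 Size (For 2 Size (step_prog (Var 0) (Var 2) (Var 1))))
        (env(0 := t)) (1 + n * ((1 + n * (7 + 1)) + 1)) (state_set (level (Suc t)))"
      by (rule hoare_weaken[OF _ state_set_mono state_set_mono order_refl])
  qed simp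
  then show ?thesis
    by (rule hoare_weaken) (auto simp: algebra_simps)
qed

lemma hoare_det_prog:
  "hoare {} det_prog env (20 * (n\<^sup>2 * (1 + lam 1))) {(0, entry (lam 1) n n)}"
proof -
  have out: "hoare (state_set (level (lam 1))) (Copy (Lit 0) (entry_cell (Lam (Lit 1)) Size Size)) env 1
      {(0, entry (lam 1) n n)}"
    by (rule hoare_Copy[of _ _ "entry (lam 1) n n"])
      (use n_pos entries_mem[of "lam 1" n n "level (lam 1)"] in \<open>auto simp: put_def\<close>)
  have "hoare {} det_prog env
     ((2 * n + 2) + ((2 + n * (3 + 3 * n)) + ((1 + n * (2 + 2 * n)) + ((1 + lam 1 * (2 + n * (2 + n * 8))) + 1))))
     {(0, entry (lam 1) n n)}"
    unfolding det_prog_def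
    by (intro hoare_Seq[OF hoare_products] hoare_Seq[OF hoare_vandermonde] hoare_Seq[OF hoare_first_level]
        hoare_Seq[OF hoare_levels] out)
  then show ?thesis
  proof (rule hoare_weaken)
    \<comment> \<open>Replacing 1 and n by n^2 bounds the fixed part by 19 n^2 and each level by 12
      n^2; 20 covers both.\<close>
    have n: "1 \<le> n\<^sup>2" "n \<le> n\<^sup>2"
      using n_pos by (auto simp: power2_eq_square)
    have "2 + n * (2 + n * 8) = 2 + 2 * n + 8 * n\<^sup>2"
      by (simp add: power2_eq_square algebra_simps)
    also have "\<dots> \<le> 12 * n\<^sup>2"
      using n by linarith
    finally have "lam 1 * (2 + n * (2 + n * 8)) \<le> lam 1 * (12 * n\<^sup>2)"
      by (rule mult_left_mono) simp
    moreover have "(2 * n + 2) + (2 + n * (3 + 3 * n)) + (1 + n * (2 + 2 * n)) + 2 = 7 + 7 * n + 5 * n\<^sup>2"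
      by (simp add: power2_eq_square algebra_simps)
    moreover have "7 + 7 * n + 5 * n\<^sup>2 \<le> 19 * n\<^sup>2"
      using n by linarith
    moreover have "20 * (n\<^sup>2 * (1 + lam 1)) = 20 * n\<^sup>2 + lam 1 * (20 * n\<^sup>2)"
      by (simp add: algebra_simps)
    moreover have "lam 1 * (12 * n\<^sup>2) \<le> lam 1 * (20 * n\<^sup>2)"
      by simp
    ultimately show "(2 * n + 2) + ((2 + n * (3 + 3 * n)) + ((1 + n * (2 + 2 * n)) +
        ((1 + lam 1 * (2 + n * (2 + n * 8))) + 1))) \<le> 20 * (n\<^sup>2 * (1 + lam 1))"
      by linarith
  qed auto
qed

end

section \<open>The output, the error threshold and the cost bounds\<close>

lemma (in truncated_table) entry_last:
  assumes "strict_mono_on {1..n} \<mu>" "\<And>j. j \<in> {1..n} \<Longrightarrow> lam j = partition_of n \<mu> j"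
    and "\<And>r. r < n \<Longrightarrow> y r = x (n - r)"
  shows "entry (lam 1) n n = det (gen_vandermonde n \<mu> x)"
proof -
  \<comment> \<open>No part of \<lambda> exceeds \<open>lam 1\<close>, so the truncation at this
    level has no effect.\<close>
  have "trunc_exp (lam 1) n i = \<mu> (Suc i)" if "i < n" for i
  proof -
    have "lam (n - i) \<le> lam 1"
      using that by (intro lam_antimono) auto
    then show ?thesis
      using that partition_of_exponent[OF assms(1), of "n - i"] assms(2)[of "n - i"]
      by (simp add: trunc_exp_def Suc_le_eq)
  qed
  then have "entry (lam 1) n n = power_det y n (\<lambda>i. \<mu> (Suc i))"
    unfolding entry_def by (rule power_det_cong)
  also have "\<dots> = power_det (\<lambda>r. x (n - r)) n (\<lambda>i. \<mu> (Suc i))"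
    unfolding power_det_def using assms(3) by (intro arg_cong[of _ _ det] eq_matI) auto
  finally show ?thesis
    by (simp add: det_gen_vandermonde_eq)
qed

text \<open>Any factor below 2 gives relative error below one; 4 / 3 is the reciprocal of the bound
  3 / 4 that Bernoulli's inequality provides.\<close>

lemma near_accurate:
  assumes "near R out e" "0 < e" "1 \<le> R" "R \<le> 4 / 3"
  shows "accurate out e"
proof -
  have "near (4 / 3) out e"
    using near_mono assms by blast
  then show ?thesis
    using assms(2) by (auto simp: near_def accurate_def)
qed

lemma inverse_power_le:
  fixes \<epsilon> :: real
  assumes "0 \<le> \<epsilon>" "\<epsilon> \<le> 1 / (4 * real m)" "0 < m"
  shows "(1 / (1 - \<epsilon>)) ^ m \<le> 4 / 3"
proof -
  have "real m * \<epsilon> \<le> 1 / 4"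
    using assms by (simp add: field_simps)
  moreover have "1 * \<epsilon> \<le> real m * \<epsilon>"
    using assms by (intro mult_right_mono) auto
  ultimately have "3 / 4 \<le> (1 - \<epsilon>) ^ m"
    using Bernoulli_inequality[of "- \<epsilon>" m] by simp
  then have "1 / (1 - \<epsilon>) ^ m \<le> 1 / (3 / 4)"
    by (intro divide_left_mono) auto
  then show ?thesis
    by (simp add: power_one_over)
qed

text \<open>In the product the factor for j = 1 alone dominates 1 + \<open>lam 1\<close>; all others
  are at least 1.\<close>

lemma size_bounds:
  fixes lam :: "nat \<Rightarrow> nat"
  assumes "1 \<le> n"
  shows "1 + real (lam 1) \<le> (\<Prod>j = 1..n. (real (lam j) + 1) ^ 2)"
    "n \<le> input_size n lam" "lam 1 \<le> input_size n lam"
proof -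
  have "1 + real (lam 1) \<le> (real (lam 1) + 1) ^ 2"
    using self_le_power[of "real (lam 1) + 1" 2] by simp
  also have "\<dots> \<le> (real (lam 1) + 1) ^ 2 * (\<Prod>j \<in> {1..n} - {1}. (real (lam j) + 1) ^ 2)"
    using prod_ge_1[of "{1..n} - {1}" "\<lambda>j. (real (lam j) + 1) ^ 2"]
    by (intro mult_le_cancel_left1[THEN iffD2]) (auto simp: one_le_power)
  also have "\<dots> = (\<Prod>j = 1..n. (real (lam j) + 1) ^ 2)"
    using assms by (intro prod.remove[symmetric]) auto
  finally show "1 + real (lam 1) \<le> (\<Prod>j = 1..n. (real (lam j) + 1) ^ 2)" .
  show "n \<le> input_size n lam"
    by (simp add: input_size_def)
  show "lam 1 \<le> input_size n lam"
    unfolding input_size_def using assms member_le_sum[of 1 "{1..n}" lam] by auto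
qed

lemma det_prog_correct:
  fixes x \<delta> :: "nat \<Rightarrow> real"
  assumes n: "1 \<le> n" and \<mu>: "strict_mono_on {1..n} \<mu>"
  defines "lam \<equiv> partition_of n \<mu>"
  defines "T\<^sub>0 \<equiv> 20 * (n\<^sup>2 * (1 + lam 1))"
  assumes \<epsilon>: "0 \<le> \<epsilon>" "\<epsilon> \<le> 1 / (4 * real (4 ^ T\<^sub>0))" "\<And>t. \<bar>\<delta> t\<bar> \<le> \<epsilon>"
    and x: "\<And>i. i \<in> {1..n} \<Longrightarrow> 0 \<le> x i" and tp: "totally_positive (gen_vandermonde n \<mu> x)"
  shows "\<exists>out T. evaluates det_prog n lam x \<delta> out T \<and>
    accurate out (det (gen_vandermonde n \<mu> x)) \<and> T \<le> T\<^sub>0"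
proof -
  \<comment> \<open>\<open>partition_of\<close> outside 1, ..., n depends on irrelevant values of
    \<mu>; L is the function that \<open>evaluates\<close> passes to the run.\<close>
  define L where "L = (\<lambda>j. if j \<in> {1..n} then lam j else 0)"
  \<comment> \<open>The lower bound 1 - \<epsilon> of a rounding factor fixes \<rho>; it also covers
    1 + \<epsilon>, since (1 + \<epsilon>) (1 - \<epsilon>) \<le> 1.\<close>
  define \<rho> where "\<rho> = 1 / (1 - \<epsilon>)"
  have "1 / (4 * real (4 ^ T\<^sub>0)) \<le> 1 / 4"
    by simp
  then have \<epsilon>1: "\<epsilon> \<le> 1 / 4"
    using \<epsilon>(2) by linarith
  interpret rounded_run n L x \<delta> \<rho>
  proof
    show "L j \<le> L i" if "1 \<le> i" "i \<le> j" "j \<le> n" for i j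
      using partition_of_antimono[OF \<mu>] that by (simp add: L_def lam_def)
    show "x (n - j) < x (n - i)" if "i < j" "j < n" for i j
      using that by (intro totally_positive_increasing[OF tp \<mu> x]) auto
    show "1 / \<rho> \<le> 1 + \<delta> t" for t
      using \<epsilon>(3)[of t] by (simp add: \<rho>_def abs_le_iff)
    show "1 + \<delta> t \<le> \<rho>" for t
    proof -
      have "(1 + \<delta> t) * (1 - \<epsilon>) \<le> (1 + \<epsilon>) * (1 - \<epsilon>)"
        using \<epsilon>(3)[of t] \<epsilon>1 by (intro mult_right_mono) auto
      also have "\<dots> \<le> 1"
        by (simp add: algebra_simps)
      finally show ?thesis
        using \<epsilon>1 by (simp add: \<rho>_def pos_le_divide_eq)
    qed
  qed (use n x \<epsilon>(1) \<epsilon>1 in \<open>auto simp: \<rho>_def\<close>)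
  have "sat {} (initial_state n x)"
    by (auto simp: sat_def initial_state_def)
  with hoare_det_prog obtain s where s: "exec n L \<delta> det_prog (\<lambda>_. 0) (initial_state n x) = Some s"
    "sat {(0, entry (L 1) n n)} s" "snd s \<le> snd (initial_state n x) + 20 * (n\<^sup>2 * (1 + L 1))"
    by (rule hoareE)
  have T: "snd s \<le> T\<^sub>0"
    using s(3) n by (simp add: initial_state_def T\<^sub>0_def L_def)
  have "entry (L 1) n n = det (gen_vandermonde n \<mu> x)"
    by (rule entry_last[OF \<mu>]) (auto simp: L_def lam_def)
  then have near: "near (err (snd s)) (fst s 0) (det (gen_vandermonde n \<mu> x))"
    using s(2) by (simp add: sat_def)
  have "err (snd s) \<le> err T\<^sub>0"
    using T by (rule err_mono)
  also have "\<dots> \<le> 4 / 3"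
    unfolding err_def unfolding \<rho>_def using \<epsilon>(1,2) by (intro inverse_power_le) auto
  finally have "accurate (fst s 0) (det (gen_vandermonde n \<mu> x))"
    using near_accurate[OF near totally_positive_det[OF tp n] err_ge_1] by blast
  moreover have "evaluates det_prog n lam x \<delta> (fst s 0) (snd s)"
    using s(1) unfolding evaluates_def L_def by (intro exI[of _ "fst s"]) simp
  ultimately show ?thesis
    using T by blast
qed

theorem mainTheorem6:
  shows "\<exists>(p :: prog) (C :: real) (q :: real poly).
    \<forall>(n :: nat) (\<mu> :: nat \<Rightarrow> nat). n \<ge> 1 \<longrightarrow> strict_mono_on {1..n} \<mu> \<longrightarrow>
      (let lam = partition_of n \<mu> in
        (\<forall>x :: nat \<Rightarrow> real. (\<forall>i\<in>{1..n}. 0 \<le> x i) \<longrightarrow> totally_positive (gen_vandermonde n \<mu> x) \<longrightarrow>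
           det (gen_vandermonde n \<mu> x) =
             (\<Prod>j = 1..n. \<Prod>i = 1..<j. x j - x i) * schur n lam x) \<and>
        (\<exists>\<epsilon>\<^sub>0 > 0. \<forall>(\<epsilon> :: real) (x :: nat \<Rightarrow> real) (\<delta> :: nat \<Rightarrow> real).
           0 \<le> \<epsilon> \<longrightarrow> \<epsilon> \<le> \<epsilon>\<^sub>0 \<longrightarrow> (\<forall>t. \<bar>\<delta> t\<bar> \<le> \<epsilon>) \<longrightarrow>
           (\<forall>i\<in>{1..n}. 0 \<le> x i) \<longrightarrow> totally_positive (gen_vandermonde n \<mu> x) \<longrightarrow>
           (\<exists>out T. evaluates p n lam x \<delta> out T \<and>
              accurate out (det (gen_vandermonde n \<mu> x)) \<and>
              real T \<le> C * (real n ^ 2 * (\<Prod>j = 1..n. (real (lam j) + 1) ^ 2)) \<and>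
              real T \<le> poly q (real (input_size n lam)))))"
proof (intro exI[of _ det_prog] exI[of _ "20 :: real"] exI[of _ "[:0, 0, 20, 20:]"] allI impI, unfold Let_def, rule conjI)
  fix n :: nat and \<mu> :: "nat \<Rightarrow> nat"
  assume n: "1 \<le> n" and \<mu>: "strict_mono_on {1..n} \<mu>"
  let ?lam = "partition_of n \<mu>"
  define T\<^sub>0 where "T\<^sub>0 = 20 * (n\<^sup>2 * (1 + ?lam 1))"
  show "\<forall>x. (\<forall>i\<in>{1..n}. 0 \<le> x i) \<longrightarrow> totally_positive (gen_vandermonde n \<mu> x) \<longrightarrow>
      det (gen_vandermonde n \<mu> x) = (\<Prod>j = 1..n. \<Prod>i = 1..<j. x j - x i) * schur n ?lam x"
    using det_eq_schur[OF \<mu>] totally_positive_increasing[OF _ \<mu>] by simp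
  have T: "real T \<le> 20 * (real n ^ 2 * (\<Prod>j = 1..n. (real (?lam j) + 1) ^ 2))"
    "real T \<le> poly [:0, 0, 20, 20:] (real (input_size n ?lam))" if "T \<le> T\<^sub>0" for T
  proof -
    have "real T \<le> real T\<^sub>0"
      using that by simp
    then have *: "real T \<le> 20 * (real n ^ 2 * (1 + real (?lam 1)))"
      by (simp add: T\<^sub>0_def algebra_simps)
    also have "\<dots> \<le> 20 * (real n ^ 2 * (\<Prod>j = 1..n. (real (?lam j) + 1) ^ 2))"
      by (intro mult_left_mono size_bounds n) auto
    finally show "real T \<le> 20 * (real n ^ 2 * (\<Prod>j = 1..n. (real (?lam j) + 1) ^ 2))" .
    \<comment> \<open>As n and \<open>lam 1\<close> are at most s, the cost is at most 20 s^2 (1 +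
      s), which is the polynomial given as witness.\<close>
    let ?s = "real (input_size n ?lam)"
    note *
    also have "20 * (real n ^ 2 * (1 + real (?lam 1))) \<le> 20 * (?s ^ 2 * (1 + ?s))"
      using size_bounds(2,3)[OF n, of ?lam]
      by (intro mult_left_mono mult_mono power_mono add_left_mono) auto
    also have "\<dots> = poly [:0, 0, 20, 20:] ?s"
      by (simp add: power2_eq_square algebra_simps)
    finally show "real T \<le> poly [:0, 0, 20, 20:] ?s" .
  qed
  show "\<exists>\<epsilon>\<^sub>0 > 0. \<forall>(\<epsilon> :: real) (x :: nat \<Rightarrow> real) (\<delta> :: nat \<Rightarrow> real).
       0 \<le> \<epsilon> \<longrightarrow> \<epsilon> \<le> \<epsilon>\<^sub>0 \<longrightarrow> (\<forall>t. \<bar>\<delta> t\<bar> \<le> \<epsilon>) \<longrightarrow>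
       (\<forall>i\<in>{1..n}. 0 \<le> x i) \<longrightarrow> totally_positive (gen_vandermonde n \<mu> x) \<longrightarrow>
       (\<exists>out T. evaluates det_prog n ?lam x \<delta> out T \<and>
          accurate out (det (gen_vandermonde n \<mu> x)) \<and>
          real T \<le> 20 * (real n ^ 2 * (\<Prod>j = 1..n. (real (?lam j) + 1) ^ 2)) \<and>
          real T \<le> poly [:0, 0, 20, 20:] (real (input_size n ?lam)))"
  \<comment> \<open>After at most \<open>T\<^sub>0\<close> steps the error factor is at most \<rho>
    to the power \<open>4 ^ T\<^sub>0\<close>; the threshold is a quarter of the reciprocal of that
    exponent, as Bernoulli's inequality requires.\<close>
  proof (rule exI[of _ "1 / (4 * real (4 ^ T\<^sub>0))"], intro conjI allI impI)
    fix \<epsilon> :: real and x \<delta> :: "nat \<Rightarrow> real"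
    assume "0 \<le> \<epsilon>" "\<epsilon> \<le> 1 / (4 * real (4 ^ T\<^sub>0))" "\<forall>t. \<bar>\<delta> t\<bar> \<le> \<epsilon>"
      "\<forall>i\<in>{1..n}. 0 \<le> x i" "totally_positive (gen_vandermonde n \<mu> x)"
    then obtain out T where "evaluates det_prog n ?lam x \<delta> out T"
      "accurate out (det (gen_vandermonde n \<mu> x))" "T \<le> T\<^sub>0"
      using det_prog_correct[OF n \<mu>, folded T\<^sub>0_def, of \<epsilon> \<delta> x] by blast
    with T show "\<exists>out T. evaluates det_prog n ?lam x \<delta> out T \<and>
          accurate out (det (gen_vandermonde n \<mu> x)) \<and>
          real T \<le> 20 * (real n ^ 2 * (\<Prod>j = 1..n. (real (?lam j) + 1) ^ 2)) \<and>
          real T \<le> poly [:0, 0, 20, 20:] (real (input_size n ?lam))"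
      by blast
  qed simp
qed

end
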